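(* Suppose that $f\in\mathbf C^4_b(\mathbb R^d)$ and $\bar\alpha^\top e=1$, and let $T\ge1$. Then there is $L_2>0$ independent of $T$ such that $$\mathbf E|V(T)|^2\le e^{L_2T}(1+\eta_2)T^3,$$ where $\eta_2=(\bar\alpha^\top(\bar Ae)-\frac12)^2+(\bar\alpha^\top\bar b^2-\frac12)^2+(\bar\alpha^\top\bar b-\frac12)^2$ and $V$ is the process defined in the context.
   Context: Let $T>0$, $\mathbf W$ an $m$-dimensional standard Brownian motion on a filtered probability space satisfying the usual conditions, $f:\mathbb R^d\to\mathbb R^d$ Lipschitz, $X_0\in\mathbb R^d$ nonrandom, $\sigma=(\sigma_1,\dots,\sigma_m)\in\mathbb R^{d\times m}$ a constant matrix with columns $\sigma_k$. $X$ is the strong solution on $[0,T]$ of $dX(t)=f(X(t))dt+\sigma\,d\mathbf W(t)$, $X(0)=X_0$. $\mathbf C^k_b(\mathbb R^d)$: $k$ times continuously differentiable functions whose derivatives of orders $1,\dots,k$ are bounded; $\nabla f$: Jacobian; $\mathcal D^2f(x)(\xi_1,\xi_2)$: second derivative in directions $\xi_1,\xi_2$. Further $s_0\in\mathbb N^+$, $\bar A\in\mathbb R^{s_0\times s_0}$, $\bar b,\bar\alpha\in\mathbb R^{s_0}$ are given (coefficients of a stochastic Runge–Kutta method), $e=(1,\dots,1)^\top\in\mathbb R^{s_0}$, and $\bar b^2$ is the componentwise square of $\bar b$. Let $\widetilde{\mathbf W}$ be an $m$-dimensional standard Brownian motion independent of $\mathbf W$ (on an extension of the probability space). $\{V(t)\}_{t\in[0,T]}$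 is the strong solution of \begin{align*} V(t)=&\int_0^t\nabla f(X(s))V(s)\,ds+\big(\bar\alpha^\top(\bar Ae)-\tfrac12\big)T\int_0^t\nabla f(X(s))f(X(s))\,ds\\ &+\tfrac12\big(\bar\alpha^\top\bar b^2-\tfrac12\big)T\sum_{k=1}^m\int_0^t\mathcal D^2f(X(s))(\sigma_k,\sigma_k)\,ds+\big(\bar\alpha^\top\bar b-\tfrac12\big)T\int_0^t\nabla f(X(s))\sigma\,d\mathbf W(s)\\ &-\frac{T}{\sqrt{12}}\int_0^t\nabla f(X(s))\sigma\,d\widetilde{\mathbf W}(s). \end{align*} *)

theory Defs
  imports "HOL-Probability.Probability"
begin

section \<open>Functions with bounded derivatives\<close>

text \<open>
  Iterated derivatives, evaluated at a list of directions: if \<open>f\<close> is \<open>j\<close> times differentiable,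
  then \<open>nderiv f [v\<^sub>1, \<dots>, v\<^sub>j] x\<close> is the value of the \<open>j\<close>-linear map \<open>D\<^sup>j f(x)\<close> at
  \<open>(v\<^sub>1, \<dots>, v\<^sub>j)\<close>.  Lists are used because the \<open>j\<close>-linear maps have no common type for
  varying \<open>j\<close>.
\<close>

primrec nderiv ::
  "('a::real_normed_vector \<Rightarrow> 'b::real_normed_vector) \<Rightarrow> 'a list \<Rightarrow> 'a \<Rightarrow> 'b" where
  "nderiv f [] = f"
| "nderiv f (v # vs) = (\<lambda>x. frechet_derivative (nderiv f vs) (at x) v)"

abbreviation second_deriv ::
  "('a::real_normed_vector \<Rightarrow> 'b::real_normed_vector) \<Rightarrow> 'a \<Rightarrow> 'a \<Rightarrow> 'a \<Rightarrow> 'b" where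
  "second_deriv f x \<xi>1 \<xi>2 \<equiv> nderiv f [\<xi>1, \<xi>2] x"

text \<open>
  The class \<open>C\<^sup>k\<^sub>b\<close>.  On a finite-dimensional space a family of multilinear maps is differentiable
  (continuous) iff it is so after evaluation at each tuple of directions.  The last clause bounds
  the operator norms of \<open>D\<^sup>j f(x)\<close>, \<open>1 \<le> j \<le> k\<close>, uniformly in \<open>x\<close>; \<open>f\<close> itself need not be bounded.
\<close>

definition Ckb ::
  "nat \<Rightarrow> ('a::euclidean_space \<Rightarrow> 'b::real_normed_vector) \<Rightarrow> bool" where
  "Ckb k f \<longleftrightarrow>
     (\<forall>vs x. length vs < k \<longrightarrow> nderiv f vs differentiable (at x)) \<and>
     (\<forall>vs. length vs \<le> k \<longrightarrow> continuous_on UNIV (nderiv f vs)) \<and>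
     (\<forall>j\<in>{1..k}. \<exists>B. \<forall>vs x. length vs = j \<longrightarrow>
        norm (nderiv f vs x) \<le> B * prod_list (map norm vs))"


section \<open>Filtered probability spaces and Brownian motion\<close>

text \<open>
  Time is \<open>[0, \<infinity>)\<close>, embedded in \<open>real\<close>.  Since the library's \<open>filtration\<close> is indexed by a whole
  type, \<open>F\<close> also has values at negative times; nothing else depends on these, and any filtration
  on \<open>[0, \<infinity>)\<close> extends by \<open>F t = F 0\<close> for \<open>t < 0\<close>.
\<close>

definition usual_filtered_prob_space :: "'w measure \<Rightarrow> (real \<Rightarrow> 'w measure) \<Rightarrow> bool" where
  "usual_filtered_prob_space M F \<longleftrightarrow>
     prob_space M \<and>
     filtration (space M) F \<and>
     (\<forall>t. subalgebra M (F t)) \<and>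
     (\<forall>N\<in>null_sets M. \<forall>A. A \<subseteq> N \<longrightarrow> A \<in> sets (F 0)) \<and>
     (\<forall>t\<ge>0. sets (F t) = (\<Inter>u\<in>{t<..}. sets (F u)))"

definition adapted_continuous ::
  "'w measure \<Rightarrow> (real \<Rightarrow> 'w measure) \<Rightarrow> real set \<Rightarrow> (real \<Rightarrow> 'w \<Rightarrow> 'b::euclidean_space) \<Rightarrow> bool" where
  "adapted_continuous M F S X \<longleftrightarrow>
     (\<forall>t\<in>S. X t \<in> borel_measurable (F t)) \<and>
     (\<forall>\<omega>\<in>space M. continuous_on S (\<lambda>t. X t \<omega>))"

text \<open>
  Standard Brownian motion relative to the filtration \<open>F\<close>.  The last two clauses say that
  \<open>W\<^sub>t - W\<^sub>s\<close> has law \<open>N(0, (t - s) I\<^sub>m)\<close>.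
\<close>

definition std_brownian_motion ::
  "'w measure \<Rightarrow> (real \<Rightarrow> 'w measure) \<Rightarrow> (real \<Rightarrow> 'w \<Rightarrow> real^'m) \<Rightarrow> bool" where
  "std_brownian_motion M F W \<longleftrightarrow>
     adapted_continuous M F {0..} W \<and>
     (AE \<omega> in M. W 0 \<omega> = 0) \<and>
     (\<forall>s t. 0 \<le> s \<and> s < t \<longrightarrow>
        prob_space.indep_set M (sets (F s))
          (sets (vimage_algebra (space M) (\<lambda>\<omega>. W t \<omega> - W s \<omega>) borel)) \<and>
        prob_space.indep_vars M (\<lambda>_. borel) (\<lambda>i \<omega>. (W t \<omega> - W s \<omega>) $ i) UNIV \<and>
        (\<forall>i. distributed M lborel (\<lambda>\<omega>. (W t \<omega> - W s \<omega>) $ i) (normal_density 0 (sqrt (t - s)))))"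

text \<open>Independence of two processes as random elements of the path space.\<close>

definition indep_processes ::
  "'w measure \<Rightarrow> (real \<Rightarrow> 'w \<Rightarrow> 'b::topological_space) \<Rightarrow> (real \<Rightarrow> 'w \<Rightarrow> 'b) \<Rightarrow> bool"
  where
  "indep_processes M X Y \<longleftrightarrow>
     prob_space.indep_var M
       (Pi\<^sub>M {0..} (\<lambda>_. borel)) (\<lambda>\<omega>. \<lambda>t\<in>{0..}. X t \<omega>)
       (Pi\<^sub>M {0..} (\<lambda>_. borel)) (\<lambda>\<omega>. \<lambda>t\<in>{0..}. Y t \<omega>)"


section \<open>The Ito integral of square-integrable integrands\<close>

definition prog_measurable ::
  "(real \<Rightarrow> 'w measure) \<Rightarrow> real \<Rightarrow> (real \<Rightarrow> 'w \<Rightarrow> 'b::topological_space) \<Rightarrow> bool" where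
  "prog_measurable F T H \<longleftrightarrow>
     (\<forall>t\<in>{0..T}.
        (\<lambda>(s, \<omega>). H s \<omega>) \<in> borel_measurable (restrict_space borel {0..t} \<Otimes>\<^sub>M F t))"

text \<open>
  A simple process is given by its number \<open>n\<close> of steps, a partition \<open>\<tau> 0 \<le> \<dots> \<le> \<tau> n\<close> in \<open>[0, T]\<close>,
  and the value \<open>\<xi> i\<close>, bounded and known at time \<open>\<tau> i\<close>, which it takes on \<open>(\<tau> i, \<tau> (i + 1)]\<close>.
\<close>

definition simple_data ::
  "'w measure \<Rightarrow> (real \<Rightarrow> 'w measure) \<Rightarrow> real \<Rightarrow> nat \<Rightarrow> (nat \<Rightarrow> real) \<Rightarrow>
     (nat \<Rightarrow> 'w \<Rightarrow> real^'m^'d) \<Rightarrow> bool" where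
  "simple_data M F T n \<tau> \<xi> \<longleftrightarrow>
     0 \<le> \<tau> 0 \<and> (\<forall>i<n. \<tau> i \<le> \<tau> (Suc i)) \<and> \<tau> n \<le> T \<and>
     (\<forall>i<n. \<xi> i \<in> borel_measurable (F (\<tau> i))) \<and>
     (\<exists>C. \<forall>i<n. \<forall>\<omega>\<in>space M. norm (\<xi> i \<omega>) \<le> C)"

definition simple_process ::
  "nat \<Rightarrow> (nat \<Rightarrow> real) \<Rightarrow> (nat \<Rightarrow> 'w \<Rightarrow> real^'m^'d) \<Rightarrow> real \<Rightarrow> 'w \<Rightarrow> real^'m^'d" where
  "simple_process n \<tau> \<xi> t \<omega> = (\<Sum>i<n. indicat_real {\<tau> i<..\<tau> (Suc i)} t *\<^sub>R \<xi> i \<omega>)"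

definition simple_integral ::
  "nat \<Rightarrow> (nat \<Rightarrow> real) \<Rightarrow> (nat \<Rightarrow> 'w \<Rightarrow> real^'m^'d) \<Rightarrow> (real \<Rightarrow> 'w \<Rightarrow> real^'m) \<Rightarrow>
     real \<Rightarrow> 'w \<Rightarrow> real^'d" where
  "simple_integral n \<tau> \<xi> W t \<omega> =
     (\<Sum>i<n. \<xi> i \<omega> *v (W (min t (\<tau> (Suc i))) \<omega> - W (min t (\<tau> i)) \<omega>))"

text \<open>
  \<open>is_ito_integral M F W T H I\<close>: the process \<open>I\<close> is a continuous version of
  \<open>t \<mapsto> \<integral>\<^sub>0\<^sup>t H(s) dW(s)\<close> on \<open>[0, T]\<close>, for a progressively measurable matrix-valued \<open>H\<close> with
  \<open>E \<integral>\<^sub>0\<^sup>T |H(s)|\<^sup>2 ds < \<infinity>\<close>.  The integral is the \<open>L\<^sup>2\<close> limit of the integrals of simple processes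
  that approximate \<open>H\<close> in \<open>L\<^sup>2([0, T] \<times> \<Omega>)\<close>.  It is a relation because \<open>I\<close> is determined only up to
  indistinguishability.  The norm on \<open>real^'m^'d\<close> is the Frobenius norm.
\<close>

definition is_ito_integral ::
  "'w measure \<Rightarrow> (real \<Rightarrow> 'w measure) \<Rightarrow> (real \<Rightarrow> 'w \<Rightarrow> real^'m) \<Rightarrow> real \<Rightarrow>
     (real \<Rightarrow> 'w \<Rightarrow> real^'m^'d) \<Rightarrow> (real \<Rightarrow> 'w \<Rightarrow> real^'d) \<Rightarrow> bool" where
  "is_ito_integral M F W T H I \<longleftrightarrow>
     prog_measurable F T H \<and>
     (\<integral>\<^sup>+ \<omega>. (\<integral>\<^sup>+ s\<in>{0..T}. ennreal ((norm (H s \<omega>))\<^sup>2) \<partial>lborel) \<partial>M) < \<infinity> \<and>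
     adapted_continuous M F {0..T} I \<and>
     (\<exists>n \<tau> \<xi>.
        (\<forall>j. simple_data M F T (n j) (\<tau> j) (\<xi> j)) \<and>
        (\<lambda>j. \<integral>\<^sup>+ \<omega>. (\<integral>\<^sup>+ s\<in>{0..T}.
            ennreal ((norm (simple_process (n j) (\<tau> j) (\<xi> j) s \<omega> - H s \<omega>))\<^sup>2) \<partial>lborel) \<partial>M)
          \<longlonglongrightarrow> 0 \<and>
        (\<forall>t\<in>{0..T}.
          (\<lambda>j. \<integral>\<^sup>+ \<omega>.
              ennreal ((norm (simple_integral (n j) (\<tau> j) (\<xi> j) W t \<omega> - I t \<omega>))\<^sup>2) \<partial>M)
            \<longlonglongrightarrow> 0))"


section \<open>The two equations\<close>

text \<open>
  \<open>X\<close> is a solution on \<open>[0, T]\<close>, on the given space and for the given \<open>W\<close>, of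
  \<open>dX = f(X) dt + \<sigma> dW\<close>, \<open>X(0) = X0\<close>.
\<close>

definition sde_solution ::
  "'w measure \<Rightarrow> (real \<Rightarrow> 'w measure) \<Rightarrow> (real \<Rightarrow> 'w \<Rightarrow> real^'m) \<Rightarrow> real \<Rightarrow>
     (real^'d \<Rightarrow> real^'d) \<Rightarrow> real^'m^'d \<Rightarrow> real^'d \<Rightarrow> (real \<Rightarrow> 'w \<Rightarrow> real^'d) \<Rightarrow> bool" where
  "sde_solution M F W T f \<sigma> X0 X \<longleftrightarrow>
     adapted_continuous M F {0..T} X \<and>
     (\<exists>I. is_ito_integral M F W T (\<lambda>s \<omega>. \<sigma>) I \<and>
        (AE \<omega> in M. \<forall>t\<in>{0..T}.
           X t \<omega> = X0 + integral {0..t} (\<lambda>s. f (X s \<omega>)) + I t \<omega>))"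

definition ones :: "real^'s" where
  "ones = (\<chi> i. 1)"

definition csquare :: "real^'s \<Rightarrow> real^'s" where
  "csquare b = (\<chi> i. (b $ i)\<^sup>2)"

text \<open>
  The linear equation for \<open>V\<close>; here \<open>W\<close> and \<open>W'\<close> are the two independent Brownian motions, and
  \<open>I\<close>, \<open>I'\<close> stand for the integrals of \<open>\<nabla>f(X) \<sigma>\<close> with respect to \<open>W\<close> and \<open>W'\<close>.
\<close>

definition limit_eq_solution ::
  "'w measure \<Rightarrow> (real \<Rightarrow> 'w measure) \<Rightarrow> (real \<Rightarrow> 'w \<Rightarrow> real^'m) \<Rightarrow> (real \<Rightarrow> 'w \<Rightarrow> real^'m) \<Rightarrow>
     real \<Rightarrow> (real^'d \<Rightarrow> real^'d) \<Rightarrow> real^'m^'d \<Rightarrow> real^'s^'s \<Rightarrow> real^'s \<Rightarrow> real^'s \<Rightarrow>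
     (real \<Rightarrow> 'w \<Rightarrow> real^'d) \<Rightarrow> (real \<Rightarrow> 'w \<Rightarrow> real^'d) \<Rightarrow> bool" where
  "limit_eq_solution M F W W' T f \<sigma> A b \<alpha> X V \<longleftrightarrow>
     adapted_continuous M F {0..T} V \<and>
     (\<exists>I I'.
        is_ito_integral M F W T (\<lambda>s \<omega>. jacobian f (at (X s \<omega>)) ** \<sigma>) I \<and>
        is_ito_integral M F W' T (\<lambda>s \<omega>. jacobian f (at (X s \<omega>)) ** \<sigma>) I' \<and>
        (AE \<omega> in M. \<forall>t\<in>{0..T}.
           V t \<omega> =
             integral {0..t} (\<lambda>s. jacobian f (at (X s \<omega>)) *v V s \<omega>)
             + ((\<alpha> \<bullet> (A *v ones) - 1/2) * T) *\<^sub>R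
                 integral {0..t} (\<lambda>s. jacobian f (at (X s \<omega>)) *v f (X s \<omega>))
             + (1/2 * (\<alpha> \<bullet> csquare b - 1/2) * T) *\<^sub>R
                 (\<Sum>k\<in>UNIV. integral {0..t}
                    (\<lambda>s. second_deriv f (X s \<omega>) (column k \<sigma>) (column k \<sigma>)))
             + ((\<alpha> \<bullet> b - 1/2) * T) *\<^sub>R I t \<omega>
             - (T / sqrt 12) *\<^sub>R I' t \<omega>))"

definition eta2 :: "real^'s^'s \<Rightarrow> real^'s \<Rightarrow> real^'s \<Rightarrow> real" where
  "eta2 A b \<alpha> =
     (\<alpha> \<bullet> (A *v ones) - 1/2)\<^sup>2 + (\<alpha> \<bullet> csquare b - 1/2)\<^sup>2 + (\<alpha> \<bullet> b - 1/2)\<^sup>2"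

end

theory Submission
  imports Defs
begin

text \<open>
  Pathwise, \<open>|V|\<close> satisfies a linear Gronwall inequality whose forcing term consists of
  \<open>\<integral>|\<nabla>f(X) f(X)|\<close>, a bounded second-derivative term and the norms of the two Ito integrals, each
  with a prefactor of order \<open>T\<close>.  Since Gronwall's inequality is used in the form
  \<open>v(T) \<le> a(T) + B e\<^bsup>BT\<^esup> \<integral>\<^sub>0\<^sup>T a\<close>, only second moments at fixed times are needed and no maximal
  inequality.  The moments of the Ito integrals of the bounded integrands are controlled, up to a
  dimensional factor, by orthogonality of increments for simple processes and passage to the \<open>L\<^sup>2\<close> limit;
  the moments of \<open>X\<close> follow from the same Gronwall argument.  Polynomial and exponential factors in
  \<open>T\<close>, all independent of the probability space, are absorbed into \<open>e\<^bsup>L2 T\<^esup>\<close>.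
\<close>

section \<open>Growth at most exponential\<close>

text \<open>Every constant is carried as an explicit formula in \<open>T\<close> and in data fixed
  before \<open>T\<close> and before the probability space, so independence can be read off the
  final formula \<open>P\<close>. Sharp powers of \<open>T\<close> are not sought:
  \<open>T ^ 3\<close> is not extracted from the equation but inserted at the very end, where
  \<open>T \<ge> 1\<close> makes it free. What does have to survive is the dependence on the method:
  its three coefficients are kept apart until they combine into
  \<open>1 + eta2 A b \<alpha>\<close>, where the summand 1 pays for the integral against
  \<open>W'\<close>, whose coefficient \<open>T / sqrt 12\<close> contains no parameter of the
  method. The time integrals in both equations are taken path by path, and nothing is assumed about
  the joint measurability of their integrands. This is why all comparisons are made on single paths,
  and expectations are taken only of random variables at fixed times or of limits of finite
  combinations of them.\<close>

text \<open>There is no constant in front of the exponential: for \<open>T \<ge> 1\<close> a larger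
  rate \<open>q\<close> absorbs it. The absolute value makes the class closed under
  products.\<close>

definition exp_bounded :: "(real \<Rightarrow> real) \<Rightarrow> bool" where
  "exp_bounded g \<longleftrightarrow> (\<exists>q. \<forall>T\<ge>1. \<bar>g T\<bar> \<le> exp (q * T))"

lemma exp_bounded_const: "exp_bounded (\<lambda>_. c)"
  unfolding exp_bounded_def
proof (intro exI allI impI)
  fix T :: real assume T: "1 \<le> T"
  have "\<bar>c\<bar> \<le> \<bar>c\<bar> * T" using mult_left_mono[OF T abs_ge_zero[of c]] by simp
  then show "\<bar>c\<bar> \<le> exp (\<bar>c\<bar> * T)" using exp_ge_add_one_self[of "\<bar>c\<bar> * T"] by linarith
qed

lemma exp_bounded_ident: "exp_bounded (\<lambda>T. T)"
  unfolding exp_bounded_def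
proof (intro exI allI impI)
  fix T :: real assume T: "1 \<le> T"
  then show "\<bar>T\<bar> \<le> exp (1 * T)" unfolding mult_1_left using exp_ge_add_one_self[of T] by linarith
qed

lemma exp_bounded_exp: "exp_bounded (\<lambda>T. exp (c * T))"
  unfolding exp_bounded_def by (intro exI[of _ c]) simp

lemma exp_bounded_add:
  assumes "exp_bounded g" "exp_bounded h"
  shows "exp_bounded (\<lambda>T. g T + h T)"
proof -
  obtain q r where q: "\<And>T. 1 \<le> T \<Longrightarrow> \<bar>g T\<bar> \<le> exp (q * T)"
    and r: "\<And>T. 1 \<le> T \<Longrightarrow> \<bar>h T\<bar> \<le> exp (r * T)"
    using assms unfolding exp_bounded_def by blast
  show ?thesis unfolding exp_bounded_def
  proof (intro exI allI impI)
    fix T :: real assume T: "1 \<le> T"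
    have "\<bar>g T + h T\<bar> \<le> exp (q * T) + exp (r * T)" using q[OF T] r[OF T] by linarith
    also have "\<dots> \<le> exp (max q r * T) + exp (max q r * T)"
      using T by (intro add_mono) (auto intro!: mult_right_mono)
    \<comment> \<open>The factor 2 from adding two equal exponentials is at most
      \<open>exp T\<close> because \<open>T \<ge> 1\<close>, which raises the rate by 1.\<close>
    also have "\<dots> \<le> exp T * exp (max q r * T)"
    proof -
      have "2 \<le> exp T" using T exp_ge_add_one_self[of T] by linarith
      then show ?thesis using mult_right_mono[of 2 "exp T" "exp (max q r * T)"] by simp
    qed
    also have "\<dots> = exp ((1 + max q r) * T)" by (simp add: exp_add[symmetric] algebra_simps)
    finally show "\<bar>g T + h T\<bar> \<le> exp ((1 + max q r) * T)" .
  qed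
qed

lemma exp_bounded_mult:
  assumes "exp_bounded g" "exp_bounded h"
  shows "exp_bounded (\<lambda>T. g T * h T)"
proof -
  obtain q r where q: "\<And>T. 1 \<le> T \<Longrightarrow> \<bar>g T\<bar> \<le> exp (q * T)"
    and r: "\<And>T. 1 \<le> T \<Longrightarrow> \<bar>h T\<bar> \<le> exp (r * T)"
    using assms unfolding exp_bounded_def by blast
  show ?thesis unfolding exp_bounded_def
  proof (intro exI allI impI)
    fix T :: real assume T: "1 \<le> T"
    show "\<bar>g T * h T\<bar> \<le> exp ((q + r) * T)"
      using mult_mono[OF q[OF T] r[OF T]] by (simp add: abs_mult exp_add distrib_right)
  qed
qed

lemma exp_bounded_power: "exp_bounded g \<Longrightarrow> exp_bounded (\<lambda>T. g T ^ n)"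
  by (induction n) (auto intro: exp_bounded_const exp_bounded_mult)

lemmas exp_bounded_intros =
  exp_bounded_const exp_bounded_ident exp_bounded_exp exp_bounded_add exp_bounded_mult
  exp_bounded_power


section \<open>Integral inequalities\<close>

text \<open>A non-integrable \<open>g\<close> has integral 0 by convention, and \<open>h\<close> is
  nonnegative on \<open>S\<close>, so the bound holds in that case too. Derivative terms along a
  path can thus be bounded without discussing their regularity in time.\<close>

lemma norm_integral_le_integral:
  fixes g :: "real \<Rightarrow> 'b::euclidean_space"
  assumes "h integrable_on S" "\<And>x. x \<in> S \<Longrightarrow> norm (g x) \<le> h x"
  shows "norm (integral S g) \<le> integral S h"
proof (cases "g integrable_on S")
  case True
  then show ?thesis using assms by (intro integral_norm_bound_integral) auto
next
  case False
  have "0 \<le> integral S h"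
    by (rule integral_nonneg[OF assms(1)]) (use assms(2) norm_ge_zero order_trans in blast)
  then show ?thesis using False by (simp add: not_integrable_integral)
qed

text \<open>An integrating factor bounds the integral of \<open>v\<close> by
  \<open>exp (B * t)\<close> times that of \<open>a\<close>, and this is put back into the
  hypothesis at time \<open>t\<close>. The form suits a forcing term that is not monotone in time,
  such as the norm of an Ito integral.\<close>

lemma gronwall_integral:
  fixes v a :: "real \<Rightarrow> real"
  assumes t: "0 \<le> t" and B: "0 \<le> B"
    and v: "continuous_on {0..t} v" and a: "continuous_on {0..t} a"
    and a0: "\<And>s. s \<in> {0..t} \<Longrightarrow> 0 \<le> a s"
    and le: "\<And>s. s \<in> {0..t} \<Longrightarrow> v s \<le> a s + B * integral {0..s} v"
  shows "v t \<le> a t + B * exp (B * t) * integral {0..t} a"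
proof -
  define R where "R s = integral {0..s} v" for s
  define Q where "Q s = integral {0..s} a" for s
  define \<phi> where "\<phi> s = exp (- B * s) * R s - Q s" for s
  have dR: "(R has_real_derivative v s) (at s within {0..t})" if "s \<in> {0..t}" for s
    unfolding R_def using integral_has_real_derivative[OF v that] .
  have dQ: "(Q has_real_derivative a s) (at s within {0..t})" if "s \<in> {0..t}" for s
    unfolding Q_def using integral_has_real_derivative[OF a that] .
  \<comment> \<open>By the hypothesis this derivative is at most
    \<open>(exp (- B * s) - 1) * a s\<close>, which is nonpositive since \<open>B\<close> and
    \<open>a\<close> are nonnegative. Hence \<open>\<phi>\<close> decreases from 0.\<close>
  have d: "(\<phi> has_real_derivative (exp (- B * s) * (v s - B * R s) - a s)) (at s within {0..t})"
    if "s \<in> {0..t}" for s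
    unfolding \<phi>_def
    by (rule derivative_eq_intros dR[OF that] dQ[OF that] refl)+ (simp add: algebra_simps)
  have "\<phi> t \<le> \<phi> 0"
  proof (rule DERIV_nonpos_imp_decreasing_open[OF t])
    show "continuous_on {0..t} \<phi>"
      unfolding continuous_on_eq_continuous_within using d DERIV_continuous by blast
    fix s assume s: "0 < s" "s < t"
    have at: "at s within {0..t} = at s" using s by (intro at_within_interior) auto
    have "exp (- B * s) * (v s - B * R s) \<le> exp (- B * s) * a s"
      using le[of s] s by (intro mult_left_mono) (auto simp: R_def)
    also have "\<dots> \<le> 1 * a s"
      using a0[of s] s B by (intro mult_right_mono) auto
    finally show "\<exists>y. (\<phi> has_real_derivative y) (at s) \<and> y \<le> 0"
      using d[of s] s at by (intro exI[of _ "exp (- B * s) * (v s - B * R s) - a s"]) auto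
  qed
  also have "\<phi> 0 = 0" by (simp add: \<phi>_def R_def Q_def)
  finally have "exp (- B * t) * R t \<le> Q t" by (simp add: \<phi>_def)
  then have "exp (B * t) * (exp (- B * t) * R t) \<le> exp (B * t) * Q t"
    by (intro mult_left_mono) auto
  then have "R t \<le> exp (B * t) * Q t" by (simp add: mult.assoc[symmetric] exp_add[symmetric])
  then have "B * R t \<le> B * (exp (B * t) * Q t)" using B by (rule mult_left_mono)
  then show ?thesis using le[of t] t by (simp add: R_def Q_def mult.assoc)
qed

text \<open>Left-endpoint sums on an equidistant grid of \<open>Suc n\<close> cells. Applied to each
  path, they exhibit a time integral as a limit of finite combinations of random variables at fixed
  times.\<close>

lemma riemann_sum_tendsto_integral:
  fixes g :: "real \<Rightarrow> real"
  assumes T: "0 \<le> T" and g: "continuous_on {0..T} g"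
  shows "(\<lambda>n. \<Sum>i<Suc n. (T / real (Suc n)) * g (T * real i / real (Suc n)))
           \<longlonglongrightarrow> integral {0..T} g"
proof (cases "T = 0")
  case True
  then show ?thesis by simp
next
  case False
  then have T: "0 < T" using T by simp
  have uc: "uniformly_continuous_on {0..T} g"
    using g by (intro compact_uniformly_continuous) auto
  show ?thesis
  proof (rule LIMSEQ_I)
    fix r :: real assume r: "0 < r"
    define \<epsilon> where "\<epsilon> = r / (2 * T)"
    have \<epsilon>: "0 < \<epsilon>" "T * \<epsilon> < r" using r T by (auto simp: \<epsilon>_def)
    obtain \<delta> where \<delta>: "0 < \<delta>"
      "\<And>x y. \<lbrakk>x \<in> {0..T}; y \<in> {0..T}; dist y x < \<delta>\<rbrakk> \<Longrightarrow> dist (g y) (g x) < \<epsilon>"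
      using uc \<epsilon>(1) unfolding uniformly_continuous_on_def by metis
    obtain N :: nat where N: "T / \<delta> < real N" using reals_Archimedean2 by blast
    show "\<exists>no. \<forall>n\<ge>no. norm ((\<Sum>i<Suc n. (T / real (Suc n)) * g (T * real i / real (Suc n)))
        - integral {0..T} g) < r"
    proof (intro exI allI impI)
      fix n assume n: "N \<le> n"
      define h where "h = T / real (Suc n)"
      have h: "0 < h" "h < \<delta>" "real (Suc n) * h = T"
      proof -
        show "0 < h" using T by (simp add: h_def)
        show "real (Suc n) * h = T" by (simp add: h_def)
        have "T / \<delta> < real (Suc n)" using N n by linarith
        then show "h < \<delta>" using \<delta>(1) by (simp add: h_def field_simps)
      qed
      \<comment> \<open>Induction over the cells: each has length \<open>h < \<delta>\<close>, so
        uniform continuity limits its error to \<open>h * \<epsilon>\<close>. For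
        \<open>k = Suc n\<close> the total is \<open>T * \<epsilon>\<close>, half of
        \<open>r\<close>.\<close>
      have main: "k \<le> Suc n \<Longrightarrow>
        \<bar>(\<Sum>i<k. h * g (h * real i)) - integral {0..h * real k} g\<bar> \<le> real k * h * \<epsilon>" for k
      proof (induction k)
        case 0
        then show ?case by simp
      next
        case (Suc k)
        have hk: "h * real (Suc k) \<le> T" using Suc.prems h
          by (metis mult.commute mult_right_mono of_nat_le_iff less_imp_le)
        have hk0: "0 \<le> h * real k" "h * real k \<le> h * real (Suc k)" using h by auto
        have gi: "g integrable_on {0..h * real (Suc k)}"
          by (rule integrable_continuous_real, rule continuous_on_subset[OF g]) (use hk in auto)
        have gi': "g integrable_on {h * real k..h * real (Suc k)}"
          by (rule integrable_continuous_real, rule continuous_on_subset[OF g]) (use hk hk0 in auto)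
        have comb: "integral {0..h * real k} g + integral {h * real k..h * real (Suc k)} g
          = integral {0..h * real (Suc k)} g"
          by (rule Henstock_Kurzweil_Integration.integral_combine[OF hk0 gi])
        have const: "integral {h * real k..h * real (Suc k)} (\<lambda>_. g (h * real k)) = h * g (h * real k)"
          using hk0 by (simp add: algebra_simps)
        have "\<bar>integral {h * real k..h * real (Suc k)} (\<lambda>s. g (h * real k) - g s)\<bar>
            \<le> integral {h * real k..h * real (Suc k)} (\<lambda>s. \<epsilon>)"
        proof (subst real_norm_def[symmetric], rule norm_integral_le_integral)
          fix s assume s: "s \<in> {h * real k..h * real (Suc k)}"
          have s0: "0 \<le> s" using s hk0(1) by (meson atLeastAtMost_iff order_trans)
          have "s \<in> {0..T}" "h * real k \<in> {0..T}" using s s0 hk hk0 by auto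
          moreover have "dist (h * real k) s < \<delta>"
            using s h(2) by (auto simp: dist_real_def algebra_simps)
          ultimately have "dist (g (h * real k)) (g s) < \<epsilon>" by (intro \<delta>(2))
          then show "norm (g (h * real k) - g s) \<le> \<epsilon>" by (simp add: dist_norm)
        qed auto
        also have "\<dots> = h * \<epsilon>" using hk0 by (simp add: algebra_simps)
        finally have "\<bar>h * g (h * real k) - integral {h * real k..h * real (Suc k)} g\<bar> \<le> h * \<epsilon>"
          unfolding Henstock_Kurzweil_Integration.integral_diff[OF integrable_const_ivl gi'] const .
        then show ?case using Suc.IH Suc.prems comb by (simp add: algebra_simps)
      qed
      have "(\<Sum>i<Suc n. (T / real (Suc n)) * g (T * real i / real (Suc n)))
          = (\<Sum>i<Suc n. h * g (h * real i))"
        unfolding h_def by (intro sum.cong refl) simp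
      then show "norm ((\<Sum>i<Suc n. (T / real (Suc n)) * g (T * real i / real (Suc n)))
          - integral {0..T} g) < r"
        using main[of "Suc n"] h(3) \<epsilon>(2) by (simp add: mult.commute)
    qed
  qed
qed

text \<open>Cauchy-Schwarz in each row; the row norms recombine to the Frobenius norm.\<close>

lemma norm_matrix_vector_mult_le:
  fixes A :: "real^'m^'d"
  shows "norm (A *v x) \<le> norm A * norm x"
proof -
  have "norm (A *v x) \<le> L2_set (\<lambda>i. norm (A $ i) * norm x) UNIV"
    unfolding norm_vec_def[of "A *v x"]
    by (rule L2_set_mono) (auto simp: matrix_vector_mul_component Cauchy_Schwarz_ineq2)
  also have "\<dots> = norm A * norm x"
    unfolding norm_vec_def[of A] by (simp add: L2_set_left_distrib)
  finally show ?thesis .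
qed


section \<open>Second moments\<close>

text \<open>The nonnegative integral makes finiteness part of the bound, so no integrability has to
  be carried along. The clause \<open>0 \<le> C\<close> is needed because \<open>ennreal\<close>
  sends negative numbers to 0.\<close>

definition moment2_le :: "'w measure \<Rightarrow> ('w \<Rightarrow> real) \<Rightarrow> real \<Rightarrow> bool" where
  "moment2_le M Y C \<longleftrightarrow>
     Y \<in> borel_measurable M \<and> 0 \<le> C \<and> (\<integral>\<^sup>+ \<omega>. ennreal ((Y \<omega>)\<^sup>2) \<partial>M) \<le> ennreal C"

lemma moment2_le_mono: "moment2_le M Y C \<Longrightarrow> C \<le> D \<Longrightarrow> moment2_le M Y D"
  unfolding moment2_le_def by (auto intro: order_trans ennreal_leI)

lemma moment2_le_AE_mono:
  assumes "Y \<in> borel_measurable M" "AE \<omega> in M. \<bar>Y \<omega>\<bar> \<le> \<bar>Z \<omega>\<bar>" "moment2_le M Z C"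
  shows "moment2_le M Y C"
proof -
  have "(\<integral>\<^sup>+ \<omega>. ennreal ((Y \<omega>)\<^sup>2) \<partial>M) \<le> (\<integral>\<^sup>+ \<omega>. ennreal ((Z \<omega>)\<^sup>2) \<partial>M)"
    by (intro nn_integral_mono_AE eventually_mono[OF assms(2)])
      (auto intro!: ennreal_leI simp: abs_le_square_iff)
  then show ?thesis using assms unfolding moment2_le_def by auto
qed

lemma moment2_le_add:
  assumes "moment2_le M Y C" "moment2_le M Z D"
  shows "moment2_le M (\<lambda>\<omega>. Y \<omega> + Z \<omega>) (2 * C + 2 * D)"
proof -
  note [measurable] = assms[unfolded moment2_le_def, THEN conjunct1]
  have "(\<integral>\<^sup>+ \<omega>. ennreal ((Y \<omega> + Z \<omega>)\<^sup>2) \<partial>M)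
      \<le> (\<integral>\<^sup>+ \<omega>. ennreal 2 * ennreal ((Y \<omega>)\<^sup>2) + ennreal 2 * ennreal ((Z \<omega>)\<^sup>2) \<partial>M)"
  proof (rule nn_integral_mono)
    fix \<omega>
    have "(Y \<omega> + Z \<omega>)\<^sup>2 \<le> 2 * (Y \<omega>)\<^sup>2 + 2 * (Z \<omega>)\<^sup>2"
      using zero_le_power2[of "Y \<omega> - Z \<omega>"] by (simp add: power2_eq_square algebra_simps)
    then show "ennreal ((Y \<omega> + Z \<omega>)\<^sup>2) \<le> ennreal 2 * ennreal ((Y \<omega>)\<^sup>2) + ennreal 2 * ennreal ((Z \<omega>)\<^sup>2)"
      using ennreal_leI[of "(Y \<omega> + Z \<omega>)\<^sup>2" "2 * (Y \<omega>)\<^sup>2 + 2 * (Z \<omega>)\<^sup>2"]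
      by (simp add: ennreal_mult')
  qed
  also have "\<dots> = ennreal 2 * (\<integral>\<^sup>+ \<omega>. ennreal ((Y \<omega>)\<^sup>2) \<partial>M) + ennreal 2 * (\<integral>\<^sup>+ \<omega>. ennreal ((Z \<omega>)\<^sup>2) \<partial>M)"
    by (simp add: nn_integral_add nn_integral_cmult)
  also have "\<dots> \<le> ennreal 2 * ennreal C + ennreal 2 * ennreal D"
    using assms unfolding moment2_le_def by (intro add_mono mult_left_mono) auto
  also have "\<dots> = ennreal (2 * C + 2 * D)"
    using assms unfolding moment2_le_def by (simp add: ennreal_mult')
  finally show ?thesis using assms unfolding moment2_le_def by auto
qed

lemma moment2_le_cmult:
  assumes "moment2_le M Y C"
  shows "moment2_le M (\<lambda>\<omega>. c * Y \<omega>) (c\<^sup>2 * C)"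
proof -
  note [measurable] = assms[unfolded moment2_le_def, THEN conjunct1]
  have "(\<integral>\<^sup>+ \<omega>. ennreal ((c * Y \<omega>)\<^sup>2) \<partial>M) = ennreal (c\<^sup>2) * (\<integral>\<^sup>+ \<omega>. ennreal ((Y \<omega>)\<^sup>2) \<partial>M)"
    by (simp add: power_mult_distrib ennreal_mult' nn_integral_cmult)
  also have "\<dots> \<le> ennreal (c\<^sup>2) * ennreal C"
    using assms unfolding moment2_le_def by (intro mult_left_mono) auto
  finally show ?thesis using assms unfolding moment2_le_def by (auto simp: ennreal_mult')
qed

lemma (in prob_space) moment2_le_const: "moment2_le M (\<lambda>_. c) (c\<^sup>2)"
  unfolding moment2_le_def by (simp add: emeasure_space_1)

text \<open>Riemann sums and Fatou's lemma avoid joint measurability of \<open>Y\<close>.\<close>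

lemma moment2_le_integral:
  assumes T: "0 \<le> T" and Y: "\<And>t. t \<in> {0..T} \<Longrightarrow> moment2_le M (Y t) C"
    and cont: "\<And>\<omega>. \<omega> \<in> space M \<Longrightarrow> continuous_on {0..T} (\<lambda>t. Y t \<omega>)"
  shows "moment2_le M (\<lambda>\<omega>. integral {0..T} (\<lambda>t. Y t \<omega>)) (T\<^sup>2 * C)"
proof -
  define R where "R n \<omega> = (\<Sum>i<Suc n. (T / real (Suc n)) * Y (T * real i / real (Suc n)) \<omega>)" for n \<omega>
  have node: "T * real i / real (Suc n) \<in> {0..T}" if "i < Suc n" for i n
    using T that mult_left_mono[of "real i" "real (Suc n)" T] by (auto simp: field_simps)
  have Ym[measurable]: "Y (T * real i / real (Suc n)) \<in> borel_measurable M" if "i < Suc n" for i n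
    using Y[OF node[OF that]] unfolding moment2_le_def by blast
  have C: "0 \<le> C" using Y[of 0] T unfolding moment2_le_def by auto
  have Rm: "R n \<in> borel_measurable M" for n
    unfolding R_def by (intro borel_measurable_sum borel_measurable_times borel_measurable_const Ym) auto
  have lim: "(\<lambda>n. R n \<omega>) \<longlonglongrightarrow> integral {0..T} (\<lambda>t. Y t \<omega>)" if "\<omega> \<in> space M" for \<omega>
    unfolding R_def by (rule riemann_sum_tendsto_integral[OF T cont[OF that]])
  have meas: "(\<lambda>\<omega>. integral {0..T} (\<lambda>t. Y t \<omega>)) \<in> borel_measurable M"
    by (rule borel_measurable_LIMSEQ_real[OF lim Rm])
  have bound: "(\<integral>\<^sup>+ \<omega>. ennreal ((R n \<omega>)\<^sup>2) \<partial>M) \<le> ennreal (T\<^sup>2 * C)" for n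
  proof -
    have "(\<integral>\<^sup>+ \<omega>. ennreal ((R n \<omega>)\<^sup>2) \<partial>M)
       \<le> (\<integral>\<^sup>+ \<omega>. (\<Sum>i<Suc n. ennreal (T\<^sup>2 / real (Suc n)) * ennreal ((Y (T * real i / real (Suc n)) \<omega>)\<^sup>2)) \<partial>M)"
    proof (rule nn_integral_mono)
      fix \<omega>
      have "(R n \<omega>)\<^sup>2 \<le> (\<Sum>i<Suc n. ((T / real (Suc n)) * Y (T * real i / real (Suc n)) \<omega>)\<^sup>2) * card {..<Suc n}"
        unfolding R_def by (rule sum_squared_le_sum_of_squares)
      \<comment> \<open>Undoes Cauchy-Schwarz bookkeeping: with \<open>N = Suc n\<close> terms, the
        squared weight \<open>(T / N)\<^sup>2\<close> times the number \<open>N\<close> of terms is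
        \<open>T\<^sup>2 / N\<close>, so \<open>N\<close> moments bounded by \<open>C\<close> add up
        to \<open>T\<^sup>2 * C\<close>.\<close>
      also have "\<dots> = (\<Sum>i<Suc n. (T\<^sup>2 / real (Suc n)) * (Y (T * real i / real (Suc n)) \<omega>)\<^sup>2)"
      proof -
        have "(T / b * y)\<^sup>2 * b = T\<^sup>2 / b * y\<^sup>2" if "b \<noteq> 0" for b y :: real
          using that by (simp add: power2_eq_square field_simps)
        then show ?thesis
          unfolding sum_distrib_right card_lessThan by (intro sum.cong refl) simp
      qed
      finally show "ennreal ((R n \<omega>)\<^sup>2)
        \<le> (\<Sum>i<Suc n. ennreal (T\<^sup>2 / real (Suc n)) * ennreal ((Y (T * real i / real (Suc n)) \<omega>)\<^sup>2))"
        by (subst ennreal_mult'[symmetric], simp, subst sum_ennreal, simp, intro ennreal_leI)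
    qed
    also have "\<dots> = (\<Sum>i<Suc n. ennreal (T\<^sup>2 / real (Suc n))
        * (\<integral>\<^sup>+ \<omega>. ennreal ((Y (T * real i / real (Suc n)) \<omega>)\<^sup>2) \<partial>M))"
    proof -
      have Yq: "(\<lambda>\<omega>. ennreal ((Y (T * real i / real (Suc n)) \<omega>)\<^sup>2)) \<in> borel_measurable M" if "i < Suc n" for i
        using Ym[OF that] by auto
      show ?thesis
        by (subst nn_integral_sum, rule borel_measurable_times_ennreal[OF borel_measurable_const Yq], simp)
          (intro sum.cong refl nn_integral_cmult Yq, simp)
    qed
    also have "\<dots> \<le> (\<Sum>i<Suc n. ennreal (T\<^sup>2 / real (Suc n)) * ennreal C)"
      using Y[OF node] unfolding moment2_le_def by (intro sum_mono mult_left_mono) auto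
    also have "\<dots> = ennreal (\<Sum>i<Suc n. T\<^sup>2 / real (Suc n) * C)"
      using C by (subst ennreal_mult'[symmetric], simp, subst sum_ennreal) auto
    also have "(\<Sum>i<Suc n. T\<^sup>2 / real (Suc n) * C) = T\<^sup>2 * C"
      by (subst sum_constant) (simp add: field_simps)
    finally show ?thesis .
  qed
  have "(\<integral>\<^sup>+ \<omega>. ennreal ((integral {0..T} (\<lambda>t. Y t \<omega>))\<^sup>2) \<partial>M)
      = (\<integral>\<^sup>+ \<omega>. liminf (\<lambda>n. ennreal ((R n \<omega>)\<^sup>2)) \<partial>M)"
  proof (rule nn_integral_cong)
    fix \<omega> assume "\<omega> \<in> space M"
    then have "(\<lambda>n. ennreal ((R n \<omega>)\<^sup>2)) \<longlonglongrightarrow> ennreal ((integral {0..T} (\<lambda>t. Y t \<omega>))\<^sup>2)"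
      by (intro tendsto_ennrealI tendsto_power lim)
    then show "ennreal ((integral {0..T} (\<lambda>t. Y t \<omega>))\<^sup>2) = liminf (\<lambda>n. ennreal ((R n \<omega>)\<^sup>2))"
      by (intro lim_imp_Liminf[symmetric]) auto
  qed
  also have "\<dots> \<le> liminf (\<lambda>n. \<integral>\<^sup>+ \<omega>. ennreal ((R n \<omega>)\<^sup>2) \<partial>M)"
    using Rm by (intro nn_integral_liminf) auto
  also have "\<dots> \<le> liminf (\<lambda>n::nat. ennreal (T\<^sup>2 * C))"
    by (intro Liminf_mono always_eventually allI bound)
  also have "\<dots> = ennreal (T\<^sup>2 * C)" by (simp add: Liminf_const)
  finally show ?thesis using meas C unfolding moment2_le_def by auto
qed

text \<open>Gronwall is applied on almost every path and only then are moments taken. One factor 2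
  comes from splitting the square of the two-term bound; \<open>T\<^sup>2\<close> is the price of
  the time integral of \<open>a\<close>. Replacing \<open>t\<close> by \<open>T\<close> in the
  constant makes it uniform in time.\<close>

lemma moment2_le_gronwall:
  assumes t: "t \<in> {0..T}" and B: "0 \<le> B"
    and v_meas: "v t \<in> borel_measurable M"
    and v: "\<And>\<omega>. \<omega> \<in> space M \<Longrightarrow> continuous_on {0..T} (\<lambda>t. v t \<omega>)"
    and v0: "\<And>\<omega>. 0 \<le> v t \<omega>"
    and a: "\<And>\<omega>. \<omega> \<in> space M \<Longrightarrow> continuous_on {0..T} (\<lambda>t. a t \<omega>)"
    and a0: "\<And>t \<omega>. t \<in> {0..T} \<Longrightarrow> \<omega> \<in> space M \<Longrightarrow> 0 \<le> a t \<omega>"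
    and a2: "\<And>t. t \<in> {0..T} \<Longrightarrow> moment2_le M (a t) C"
    and le: "AE \<omega> in M. \<forall>t\<in>{0..T}. v t \<omega> \<le> a t \<omega> + B * integral {0..t} (\<lambda>s. v s \<omega>)"
  shows "moment2_le M (v t) ((2 + 2 * (B * exp (B * T))\<^sup>2 * T\<^sup>2) * C)"
proof (rule moment2_le_AE_mono[OF v_meas])
  have t0: "0 \<le> t" "t \<le> T" and sub: "{0..t} \<subseteq> {0..T}" using t by auto
  have C: "0 \<le> C" using a2[OF t] unfolding moment2_le_def by blast
  have "moment2_le M (\<lambda>\<omega>. integral {0..t} (\<lambda>s. a s \<omega>)) (t\<^sup>2 * C)"
    by (rule moment2_le_integral[OF t0(1)]) (use a2 a t0 in \<open>auto intro: continuous_on_subset[OF _ sub]\<close>)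
  note moment2_le_add[OF a2[OF t] moment2_le_cmult[OF this, of "B * exp (B * t)"]]
  moreover have "2 * C + 2 * ((B * exp (B * t))\<^sup>2 * (t\<^sup>2 * C)) \<le> (2 + 2 * (B * exp (B * T))\<^sup>2 * T\<^sup>2) * C"
  proof -
    have "(B * exp (B * t))\<^sup>2 * t\<^sup>2 \<le> (B * exp (B * T))\<^sup>2 * T\<^sup>2"
      using t0 B by (intro mult_mono power_mono mult_left_mono) (auto intro: mult_left_mono)
    then have "(2 + 2 * ((B * exp (B * t))\<^sup>2 * t\<^sup>2)) * C \<le> (2 + 2 * ((B * exp (B * T))\<^sup>2 * T\<^sup>2)) * C"
      using C by (intro mult_right_mono) auto
    then show ?thesis by (simp add: distrib_right mult.assoc)
  qed
  ultimately show "moment2_le M (\<lambda>\<omega>. a t \<omega> + B * exp (B * t) * integral {0..t} (\<lambda>s. a s \<omega>))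
      ((2 + 2 * (B * exp (B * T))\<^sup>2 * T\<^sup>2) * C)"
    by (rule moment2_le_mono)
  show "AE \<omega> in M. \<bar>v t \<omega>\<bar> \<le> \<bar>a t \<omega> + B * exp (B * t) * integral {0..t} (\<lambda>s. a s \<omega>)\<bar>"
    using le AE_space
  proof eventually_elim
    case (elim \<omega>)
    have "v t \<omega> \<le> a t \<omega> + B * exp (B * t) * integral {0..t} (\<lambda>s. a s \<omega>)"
      by (rule gronwall_integral[of t B "\<lambda>t. v t \<omega>" "\<lambda>t. a t \<omega>"])
        (use t0 B v a a0 elim in \<open>auto intro: continuous_on_subset[OF _ sub]\<close>)
    then show ?case using v0[of \<omega>] by linarith
  qed
qed

lemma moment2_leD:
  assumes "moment2_le M Y C"
  shows "integrable M (\<lambda>\<omega>. (Y \<omega>)\<^sup>2)" and "(\<integral>\<omega>. (Y \<omega>)\<^sup>2 \<partial>M) \<le> C"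
proof -
  note Y = assms[unfolded moment2_le_def]
  show "integrable M (\<lambda>\<omega>. (Y \<omega>)\<^sup>2)"
    by (rule integrableI_nonneg) (use Y in \<open>auto intro: le_less_trans\<close>)
  then have "ennreal (\<integral>\<omega>. (Y \<omega>)\<^sup>2 \<partial>M) \<le> ennreal C"
    using Y nn_integral_eq_integral[of M "\<lambda>\<omega>. (Y \<omega>)\<^sup>2"] by auto
  then show "(\<integral>\<omega>. (Y \<omega>)\<^sup>2 \<partial>M) \<le> C" using Y by (simp add: ennreal_le_iff)
qed


section \<open>Moments of Ito integrals\<close>

lemma borel_measurable_matrix_vector_mult:
  fixes A :: "'w \<Rightarrow> real^'m^'d" and x :: "'w \<Rightarrow> real^'m"
  assumes "A \<in> borel_measurable N" "x \<in> borel_measurable N"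
  shows "(\<lambda>\<omega>. A \<omega> *v x \<omega>) \<in> borel_measurable N"
proof (rule borel_measurable_continuous_Pair[OF assms])
  show "continuous_on UNIV (\<lambda>p. fst p *v snd p :: real^'d)"
    unfolding matrix_vector_mult_def by (intro continuous_intros)
qed

lemma borel_measurable_vec_nth:
  fixes x :: "'w \<Rightarrow> 'b::euclidean_space^'n"
  assumes "x \<in> borel_measurable N"
  shows "(\<lambda>\<omega>. x \<omega> $ i) \<in> borel_measurable N"
  by (rule borel_measurable_continuous_on[OF _ assms]) (intro continuous_intros)

lemma usual_filtered_prob_space_measurable:
  assumes F: "usual_filtered_prob_space M F" and Y: "Y \<in> measurable (F s) N"
  shows "s \<le> t \<Longrightarrow> Y \<in> measurable (F t) N" and "Y \<in> measurable M N"
proof -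
  have "subalgebra M (F s)" using F unfolding usual_filtered_prob_space_def by blast
  then show "Y \<in> measurable M N" using Y by (rule measurable_from_subalg)
  assume "s \<le> t"
  moreover have "filtration (space M) F" using F unfolding usual_filtered_prob_space_def by blast
  ultimately have "subalgebra (F t) (F s)"
    unfolding subalgebra_def
    by (simp add: filtration.space_F filtration.sets_F_mono)
  then show "Y \<in> measurable (F t) N" using Y by (rule measurable_from_subalg)
qed

section \<open>Brownian increments and a single step of the stochastic integral\<close>

text \<open>Independence is stated for an arbitrary Borel function \<open>g\<close> of the increment
  because two are used later: a coordinate, for the mixed term, and the squared norm, for the
  quadratic term.\<close>

lemma brownian_increment:
  fixes W :: "real \<Rightarrow> 'w \<Rightarrow> real^'m"
  assumes F: "usual_filtered_prob_space M F" and W: "std_brownian_motion M F W"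
    and st: "0 \<le> s" "s < t"
  shows brownian_increment_integrable: "integrable M (\<lambda>\<omega>. (W t \<omega> - W s \<omega>) $ i)"
    and brownian_increment_mean: "(\<integral>\<omega>. (W t \<omega> - W s \<omega>) $ i \<partial>M) = 0"
    and brownian_increment_norm_integrable: "integrable M (\<lambda>\<omega>. (norm (W t \<omega> - W s \<omega>))\<^sup>2)"
    and brownian_increment_norm: "(\<integral>\<omega>. (norm (W t \<omega> - W s \<omega>))\<^sup>2 \<partial>M) = real CARD('m) * (t - s)"
    and brownian_increment_indep: "\<And>Z g. Z \<in> borel_measurable (F s) \<Longrightarrow> g \<in> borel_measurable borel \<Longrightarrow>
          prob_space.indep_var M borel Z borel (\<lambda>\<omega>. g (W t \<omega> - W s \<omega>) :: real)"
proof -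
  interpret prob_space M using F unfolding usual_filtered_prob_space_def by blast
  have d: "distributed M lborel (\<lambda>\<omega>. (W t \<omega> - W s \<omega>) $ i) (normal_density 0 (sqrt (t - s)))" for i
    using W st unfolding std_brownian_motion_def by blast
  have m1: "integrable M (\<lambda>\<omega>. (W t \<omega> - W s \<omega>) $ i)" for i
    using distributed_integrable[OF d, of "\<lambda>x. x" i]
      integrable_normal_moment[of "sqrt (t - s)" 0 1] st by simp
  have m2: "integrable M (\<lambda>\<omega>. ((W t \<omega> - W s \<omega>) $ i)\<^sup>2)" for i
    using distributed_integrable[OF d, of "\<lambda>x. x\<^sup>2" i]
      integrable_normal_moment[of "sqrt (t - s)" 0 2] st by simp
  have e1: "expectation (\<lambda>\<omega>. (W t \<omega> - W s \<omega>) $ i) = 0" for i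
    using normal_distributed_expectation[OF _ d, of i] st by simp
  \<comment> \<open>The mean is zero, so the variance is the second moment.\<close>
  have e2: "expectation (\<lambda>\<omega>. ((W t \<omega> - W s \<omega>) $ i)\<^sup>2) = t - s" for i
    using normal_distributed_variance[OF _ d, of i] st unfolding e1 by simp
  have sq: "(norm x)\<^sup>2 = (\<Sum>i\<in>UNIV. (x $ i)\<^sup>2)" for x :: "real^'m"
    unfolding power2_norm_eq_inner inner_vec_def by (simp add: power2_eq_square)
  show "integrable M (\<lambda>\<omega>. (W t \<omega> - W s \<omega>) $ i)" by (rule m1)
  show "(\<integral>\<omega>. (W t \<omega> - W s \<omega>) $ i \<partial>M) = 0" by (rule e1)
  show "integrable M (\<lambda>\<omega>. (norm (W t \<omega> - W s \<omega>))\<^sup>2)"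
    unfolding sq by (intro Bochner_Integration.integrable_sum m2)
  show "(\<integral>\<omega>. (norm (W t \<omega> - W s \<omega>))\<^sup>2 \<partial>M) = real CARD('m) * (t - s)"
    unfolding sq by (subst Bochner_Integration.integral_sum) (auto simp: m2 e2 simp del: vector_minus_component)
  fix Z :: "'w \<Rightarrow> real" and g :: "real^'m \<Rightarrow> real"
  assume Z: "Z \<in> borel_measurable (F s)" and g: "g \<in> borel_measurable borel"
  have Wm: "W u \<in> borel_measurable M" if "0 \<le> u" for u
    using W that usual_filtered_prob_space_measurable(2)[OF F, of "W u" u borel]
    unfolding std_brownian_motion_def adapted_continuous_def by auto
  have inc: "(\<lambda>\<omega>. W t \<omega> - W s \<omega>) \<in> borel_measurable M" using Wm st by auto
  have ZM: "Z \<in> borel_measurable M" by (rule usual_filtered_prob_space_measurable(2)[OF F Z])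
  have "subalgebra M (F s)" using F unfolding usual_filtered_prob_space_def by blast
  then have sp: "space (F s) = space M" by (simp add: subalgebra_def)
  have indep: "indep_set (sets (F s)) (sets (vimage_algebra (space M) (\<lambda>\<omega>. W t \<omega> - W s \<omega>) borel))"
    using W st unfolding std_brownian_motion_def by blast
  have 1: "sigma_sets (space M) {Z -` A \<inter> space M |A. A \<in> sets borel} \<subseteq> sets (F s)"
    using sets.sigma_sets_subset[of "{Z -` A \<inter> space M |A. A \<in> sets borel}" "F s"]
      measurable_sets[OF Z] unfolding sp by auto
  have 2: "sigma_sets (space M) {(\<lambda>\<omega>. g (W t \<omega> - W s \<omega>)) -` A \<inter> space M |A. A \<in> sets borel}
     \<subseteq> sets (vimage_algebra (space M) (\<lambda>\<omega>. W t \<omega> - W s \<omega>) borel)"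
  proof -
    have "(\<lambda>\<omega>. g (W t \<omega> - W s \<omega>)) \<in> borel_measurable (vimage_algebra (space M) (\<lambda>\<omega>. W t \<omega> - W s \<omega>) borel)"
      by (rule measurable_compose[OF measurable_vimage_algebra1 g]) auto
    from measurable_sets[OF this] show ?thesis
      using sets.sigma_sets_subset[of "{(\<lambda>\<omega>. g (W t \<omega> - W s \<omega>)) -` A \<inter> space M |A. A \<in> sets borel}"
        "vimage_algebra (space M) (\<lambda>\<omega>. W t \<omega> - W s \<omega>) borel"] by auto
  qed
  show "indep_var borel Z borel (\<lambda>\<omega>. g (W t \<omega> - W s \<omega>))"
    unfolding indep_var_eq
  proof (intro conjI)
    show "indep_set (sigma_sets (space M) {Z -` A \<inter> space M |A. A \<in> sets borel})
      (sigma_sets (space M) {(\<lambda>\<omega>. g (W t \<omega> - W s \<omega>)) -` A \<inter> space M |A. A \<in> sets borel})"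
      unfolding indep_set_def
      by (rule indep_sets_mono_sets[OF indep[unfolded indep_set_def]]) (use 1 2 in \<open>auto split: bool.split\<close>)
  qed (use ZM measurable_compose[OF inc g] in auto)
qed

text \<open>Expand the square of \<open>S + \<xi> *v (W t - W s)\<close>. The mixed term vanishes in
  expectation, since \<open>S\<close> and \<open>\<xi>\<close> are known at time \<open>s\<close>,
  and the quadratic term factorizes by independence.\<close>

lemma ito_step:
  fixes W :: "real \<Rightarrow> 'w \<Rightarrow> real^'m" and \<xi> :: "'w \<Rightarrow> real^'m^'d" and S :: "'w \<Rightarrow> real^'d"
  assumes F: "usual_filtered_prob_space M F" and W: "std_brownian_motion M F W"
    and st: "0 \<le> s" "s < t"
    and S: "S \<in> borel_measurable (F s)" "integrable M (\<lambda>\<omega>. (norm (S \<omega>))\<^sup>2)"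
    and \<xi>: "\<xi> \<in> borel_measurable (F s)" "\<And>\<omega>. \<omega> \<in> space M \<Longrightarrow> norm (\<xi> \<omega>) \<le> C"
  defines "S' \<equiv> \<lambda>\<omega>. S \<omega> + \<xi> \<omega> *v (W t \<omega> - W s \<omega>)"
  shows ito_step_integrable: "integrable M (\<lambda>\<omega>. (norm (S' \<omega>))\<^sup>2)"
    and ito_step_le: "(\<integral>\<omega>. (norm (S' \<omega>))\<^sup>2 \<partial>M) \<le>
      (\<integral>\<omega>. (norm (S \<omega>))\<^sup>2 \<partial>M) + real CARD('m) * (t - s) * (\<integral>\<omega>. (norm (\<xi> \<omega>))\<^sup>2 \<partial>M)"
proof -
  interpret prob_space M using F unfolding usual_filtered_prob_space_def by blast
  note inc = brownian_increment[OF F W st]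
  define D where "D \<omega> = W t \<omega> - W s \<omega>" for \<omega>
  \<comment> \<open>The \<open>c\<close>-th entry of the transpose of \<open>\<xi>\<close> applied
    to \<open>S\<close>; it collects everything in the mixed term that multiplies the
    \<open>c\<close>-th coordinate of the increment.\<close>
  define Z where "Z c \<omega> = (\<Sum>i\<in>UNIV. \<xi> \<omega> $ i $ c * S \<omega> $ i)" for c \<omega>
  have Wm: "W u \<in> borel_measurable M" if "0 \<le> u" for u
    using W that usual_filtered_prob_space_measurable(2)[OF F, of "W u" u borel]
    unfolding std_brownian_motion_def adapted_continuous_def by auto
  have Dm: "D \<in> borel_measurable M" unfolding D_def using Wm st by auto
  have Sm: "S \<in> borel_measurable M" and \<xi>m: "\<xi> \<in> borel_measurable M"
    using S(1) \<xi>(1) usual_filtered_prob_space_measurable(2)[OF F] by blast+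
  have comp: "(\<lambda>\<omega>. \<xi> \<omega> $ i $ c * S \<omega> $ i) \<in> borel_measurable N"
    if "\<xi> \<in> borel_measurable N" "S \<in> borel_measurable N" for N i c
    using that by (intro borel_measurable_times borel_measurable_vec_nth)
  have ZF: "Z c \<in> borel_measurable (F s)" for c
    unfolding Z_def using S(1) \<xi>(1) by (intro borel_measurable_sum comp)
  \<comment> \<open>The entries of \<open>\<xi>\<close> are bounded by \<open>C\<close>, and
    \<open>1 + (norm (S \<omega>))\<^sup>2\<close> dominates each coordinate of \<open>S\<close>, so
    the square-integrability of \<open>S\<close> suffices.\<close>
  have Zi: "integrable M (Z c)" for c
    unfolding Z_def
  proof (rule Bochner_Integration.integrable_sum)
    fix i
    show "integrable M (\<lambda>\<omega>. \<xi> \<omega> $ i $ c * S \<omega> $ i)"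
    proof (rule Bochner_Integration.integrable_bound)
      show "integrable M (\<lambda>\<omega>. C * (1 + (norm (S \<omega>))\<^sup>2))" using S(2) by auto
      show "AE \<omega> in M. norm (\<xi> \<omega> $ i $ c * S \<omega> $ i) \<le> norm (C * (1 + (norm (S \<omega>))\<^sup>2))"
      proof (rule AE_I2)
        fix \<omega> assume \<omega>: "\<omega> \<in> space M"
        have "\<bar>\<xi> \<omega> $ i $ c\<bar> \<le> norm (\<xi> \<omega> $ i)" by (rule component_le_norm_cart)
        also have "\<dots> \<le> norm (\<xi> \<omega>)" by (rule Finite_Cartesian_Product.norm_nth_le)
        also have "\<dots> \<le> C" using \<xi>(2)[OF \<omega>] .
        finally have 1: "\<bar>\<xi> \<omega> $ i $ c\<bar> \<le> C" .
        have "\<bar>S \<omega> $ i\<bar> \<le> norm (S \<omega>)" by (rule component_le_norm_cart)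
        also have "\<dots> \<le> 1 + (norm (S \<omega>))\<^sup>2"
        proof -
          have "2 * norm (S \<omega>) \<le> 1 + (norm (S \<omega>))\<^sup>2"
            using zero_le_power2[of "norm (S \<omega>) - 1"] by (simp add: power2_eq_square algebra_simps)
          then show ?thesis using norm_ge_zero[of "S \<omega>"] by linarith
        qed
        finally have 2: "\<bar>S \<omega> $ i\<bar> \<le> 1 + (norm (S \<omega>))\<^sup>2" .
        have "\<bar>\<xi> \<omega> $ i $ c\<bar> * \<bar>S \<omega> $ i\<bar> \<le> C * (1 + (norm (S \<omega>))\<^sup>2)"
          using 1 2 by (intro mult_mono) auto
        then show "norm (\<xi> \<omega> $ i $ c * S \<omega> $ i) \<le> norm (C * (1 + (norm (S \<omega>))\<^sup>2))"
          using order_trans[OF _ abs_ge_self] by (simp add: abs_mult[symmetric])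
      qed
    qed (use comp \<xi>m Sm in auto)
  qed
  have iv: "indep_var borel (Z c) borel (\<lambda>\<omega>. D \<omega> $ c)" for c
    unfolding D_def using inc(5)[OF ZF, of "\<lambda>x. x $ c"] borel_measurable_vec_nth[of "\<lambda>x. x"] by simp
  have Di: "integrable M (\<lambda>\<omega>. D \<omega> $ c)" for c unfolding D_def by (rule inc(1))
  have crossi: "integrable M (\<lambda>\<omega>. Z c \<omega> * D \<omega> $ c)" for c
    by (rule indep_var_integrable[OF iv Zi Di])
  have cross0: "expectation (\<lambda>\<omega>. Z c \<omega> * D \<omega> $ c) = 0" for c
    unfolding indep_var_lebesgue_integral[OF iv Zi Di] using inc(2)[of c] by (simp add: D_def)
  \<comment> \<open>\<open>Z c\<close> is known at time \<open>s\<close>, so the mixed term has mean zero.\<close>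
  have cross: "S \<omega> \<bullet> (\<xi> \<omega> *v D \<omega>) = (\<Sum>c\<in>UNIV. Z c \<omega> * D \<omega> $ c)" for \<omega>
  proof -
    have "S \<omega> \<bullet> (\<xi> \<omega> *v D \<omega>) = (\<Sum>i\<in>UNIV. \<Sum>c\<in>UNIV. \<xi> \<omega> $ i $ c * S \<omega> $ i * D \<omega> $ c)"
      by (simp add: inner_vec_def matrix_vector_mult_def sum_distrib_left mult_ac)
    also have "\<dots> = (\<Sum>c\<in>UNIV. Z c \<omega> * D \<omega> $ c)"
      unfolding Z_def sum_distrib_right by (rule sum.swap)
    finally show ?thesis .
  qed
  have ci: "integrable M (\<lambda>\<omega>. S \<omega> \<bullet> (\<xi> \<omega> *v D \<omega>))"
    unfolding cross by (intro Bochner_Integration.integrable_sum crossi)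
  have c0: "expectation (\<lambda>\<omega>. S \<omega> \<bullet> (\<xi> \<omega> *v D \<omega>)) = 0"
    unfolding cross by (subst Bochner_Integration.integral_sum) (auto simp: crossi cross0)
  have ivn: "indep_var borel (\<lambda>\<omega>. (norm (\<xi> \<omega>))\<^sup>2) borel (\<lambda>\<omega>. (norm (D \<omega>))\<^sup>2)"
    unfolding D_def using \<xi>(1) by (intro inc(5)) auto
  have \<xi>i: "integrable M (\<lambda>\<omega>. (norm (\<xi> \<omega>))\<^sup>2)"
    by (rule integrable_const_bound[of _ "C\<^sup>2"]) (use \<xi>m \<xi>(2) in \<open>auto intro!: AE_I2 power_mono\<close>)
  have Dni: "integrable M (\<lambda>\<omega>. (norm (D \<omega>))\<^sup>2)" unfolding D_def by (rule inc(3))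
  have pi: "integrable M (\<lambda>\<omega>. (norm (\<xi> \<omega>))\<^sup>2 * (norm (D \<omega>))\<^sup>2)"
    by (rule indep_var_integrable[OF ivn \<xi>i Dni])
  have pe: "expectation (\<lambda>\<omega>. (norm (\<xi> \<omega>))\<^sup>2 * (norm (D \<omega>))\<^sup>2)
      = expectation (\<lambda>\<omega>. (norm (\<xi> \<omega>))\<^sup>2) * (real CARD('m) * (t - s))"
    unfolding indep_var_lebesgue_integral[OF ivn \<xi>i Dni] using inc(4) by (simp add: D_def)
  \<comment> \<open>This inequality replaces the exact Ito isometry. It avoids the covariances
    between coordinates of the increment and is the origin of the factor
    \<open>CARD('m)\<close>.\<close>
  have le: "(norm (\<xi> \<omega> *v D \<omega>))\<^sup>2 \<le> (norm (\<xi> \<omega>))\<^sup>2 * (norm (D \<omega>))\<^sup>2" for \<omega>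
    using power_mono[OF norm_matrix_vector_mult_le, of "\<xi> \<omega>" "D \<omega>" 2] by (simp add: power_mult_distrib)
  have qi: "integrable M (\<lambda>\<omega>. (norm (\<xi> \<omega> *v D \<omega>))\<^sup>2)"
    by (rule Bochner_Integration.integrable_bound[OF pi])
      (use le borel_measurable_matrix_vector_mult[OF \<xi>m Dm] in auto)
  have exp: "(norm (S' \<omega>))\<^sup>2 = (norm (S \<omega>))\<^sup>2 + 2 * (S \<omega> \<bullet> (\<xi> \<omega> *v D \<omega>)) + (norm (\<xi> \<omega> *v D \<omega>))\<^sup>2" for \<omega>
    unfolding S'_def D_def[symmetric]
    by (simp add: power2_norm_eq_inner inner_add_left inner_add_right inner_commute)
  show "integrable M (\<lambda>\<omega>. (norm (S' \<omega>))\<^sup>2)"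
    unfolding exp using S(2) ci qi by auto
  have "expectation (\<lambda>\<omega>. (norm (S' \<omega>))\<^sup>2)
      = expectation (\<lambda>\<omega>. (norm (S \<omega>))\<^sup>2) + expectation (\<lambda>\<omega>. (norm (\<xi> \<omega> *v D \<omega>))\<^sup>2)"
    unfolding exp using S(2) ci qi c0 by simp
  also have "expectation (\<lambda>\<omega>. (norm (\<xi> \<omega> *v D \<omega>))\<^sup>2)
      \<le> expectation (\<lambda>\<omega>. (norm (\<xi> \<omega>))\<^sup>2 * (norm (D \<omega>))\<^sup>2)"
    by (rule integral_mono[OF qi pi le])
  finally show "(\<integral>\<omega>. (norm (S' \<omega>))\<^sup>2 \<partial>M) \<le>
      (\<integral>\<omega>. (norm (S \<omega>))\<^sup>2 \<partial>M) + real CARD('m) * (t - s) * (\<integral>\<omega>. (norm (\<xi> \<omega>))\<^sup>2 \<partial>M)"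
    unfolding pe by (simp add: mult_ac)
qed

section \<open>Integrals of simple processes and the passage to the limit\<close>

text \<open>Induction over the steps of the partition, adding one increment at a time with
  \<open>ito_step\<close>. The bound uses the full cell lengths, so it does not depend on
  \<open>t\<close>.\<close>

lemma simple_integral_moment:
  fixes W :: "real \<Rightarrow> 'w \<Rightarrow> real^'m" and \<xi> :: "nat \<Rightarrow> 'w \<Rightarrow> real^'m^'d"
  assumes F: "usual_filtered_prob_space M F" and W: "std_brownian_motion M F W"
    and sd: "simple_data M F T n \<tau> \<xi>" and t: "t \<in> {0..T}"
  shows "simple_integral n \<tau> \<xi> W t \<in> borel_measurable M"
    and "integrable M (\<lambda>\<omega>. (norm (simple_integral n \<tau> \<xi> W t \<omega>))\<^sup>2)"
    and "(\<integral>\<omega>. (norm (simple_integral n \<tau> \<xi> W t \<omega>))\<^sup>2 \<partial>M)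
      \<le> real CARD('m) * (\<Sum>i<n. (\<tau> (Suc i) - \<tau> i) * (\<integral>\<omega>. (norm (\<xi> i \<omega>))\<^sup>2 \<partial>M))"
proof -
  interpret prob_space M using F unfolding usual_filtered_prob_space_def by blast
  define c where "c k = min t (\<tau> k)" for k
  obtain C where C: "\<And>i \<omega>. i < n \<Longrightarrow> \<omega> \<in> space M \<Longrightarrow> norm (\<xi> i \<omega>) \<le> C"
    using sd unfolding simple_data_def by blast
  have \<tau>: "0 \<le> \<tau> 0" "\<And>i. i < n \<Longrightarrow> \<tau> i \<le> \<tau> (Suc i)"
    "\<And>i. i < n \<Longrightarrow> \<xi> i \<in> borel_measurable (F (\<tau> i))"
    using sd unfolding simple_data_def by auto
  have \<tau>0: "k \<le> n \<Longrightarrow> 0 \<le> \<tau> k" for k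
    by (induction k) (use \<tau>(1,2) in \<open>auto intro: order_trans[OF _ \<tau>(2)]\<close>)
  have c0: "k \<le> n \<Longrightarrow> 0 \<le> c k" for k using \<tau>0 t unfolding c_def by auto
  have Wm: "W u \<in> borel_measurable (F v)" if "0 \<le> u" "u \<le> v" for u v
    using W that usual_filtered_prob_space_measurable(1)[OF F, of "W u" u borel v]
    unfolding std_brownian_motion_def adapted_continuous_def by auto
  \<comment> \<open>Measurability at the stopped time \<open>c k\<close>, and not merely in
    \<open>M\<close>, is part of the induction because the next increment must be independent of the
    partial sum.\<close>
  have main: "k \<le> n \<Longrightarrow> simple_integral k \<tau> \<xi> W t \<in> borel_measurable (F (c k)) \<and>
      integrable M (\<lambda>\<omega>. (norm (simple_integral k \<tau> \<xi> W t \<omega>))\<^sup>2) \<and>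
      (\<integral>\<omega>. (norm (simple_integral k \<tau> \<xi> W t \<omega>))\<^sup>2 \<partial>M)
      \<le> real CARD('m) * (\<Sum>i<k. (\<tau> (Suc i) - \<tau> i) * (\<integral>\<omega>. (norm (\<xi> i \<omega>))\<^sup>2 \<partial>M))" for k
  proof (induction k)
    case 0
    then show ?case by (simp add: simple_integral_def)
  next
    case (Suc k)
    then have k: "k < n" by simp
    let ?S = "simple_integral k \<tau> \<xi> W t" and ?S' = "simple_integral (Suc k) \<tau> \<xi> W t"
    have IH: "?S \<in> borel_measurable (F (c k))" "integrable M (\<lambda>\<omega>. (norm (?S \<omega>))\<^sup>2)"
      "(\<integral>\<omega>. (norm (?S \<omega>))\<^sup>2 \<partial>M)
      \<le> real CARD('m) * (\<Sum>i<k. (\<tau> (Suc i) - \<tau> i) * (\<integral>\<omega>. (norm (\<xi> i \<omega>))\<^sup>2 \<partial>M))"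
      using Suc by auto
    have S': "?S' = (\<lambda>\<omega>. ?S \<omega> + \<xi> k \<omega> *v (W (c (Suc k)) \<omega> - W (c k) \<omega>))"
      by (auto simp: simple_integral_def c_def)
    have ck: "c k \<le> c (Suc k)" using \<tau>(2)[OF k] by (auto simp: c_def)
    show ?case
    proof (cases "c k = c (Suc k)")
      case True
      then have eq: "?S' = ?S" using S' by simp
      have "0 \<le> real CARD('m) * ((\<tau> (Suc k) - \<tau> k) * (\<integral>\<omega>. (norm (\<xi> k \<omega>))\<^sup>2 \<partial>M))"
        using \<tau>(2)[OF k] by (intro mult_nonneg_nonneg) auto
      then show ?thesis using IH True unfolding eq by (simp add: distrib_left)
    next
      case False
      then have less: "c k < c (Suc k)" using ck by simp
      \<comment> \<open>A nonzero stopped increment means that \<open>t\<close> lies beyond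
        \<open>\<tau> k\<close>, so \<open>\<xi> k\<close>, known at time \<open>\<tau> k\<close>,
        is known at time \<open>c k\<close>, as the step requires. Cells starting at or after
        \<open>t\<close> fall under the other case.\<close>
      then have c\<tau>: "c k = \<tau> k" unfolding c_def by auto
      have \<xi>k: "\<xi> k \<in> borel_measurable (F (c k))" using \<tau>(3)[OF k] c\<tau> by simp
      note step = ito_step[OF F W c0 less IH(1,2) \<xi>k C[OF k], OF less_imp_le[OF k]]
      have m: "?S' \<in> borel_measurable (F (c (Suc k)))"
        unfolding S'
        using usual_filtered_prob_space_measurable(1)[OF F IH(1) ck]
          usual_filtered_prob_space_measurable(1)[OF F \<xi>k ck] Wm c0 k ck
        by (intro borel_measurable_add borel_measurable_matrix_vector_mult borel_measurable_diff) auto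
      have "c (Suc k) - c k \<le> \<tau> (Suc k) - \<tau> k" unfolding c\<tau> by (simp add: c_def)
      then have "real CARD('m) * (c (Suc k) - c k) * (\<integral>\<omega>. (norm (\<xi> k \<omega>))\<^sup>2 \<partial>M)
          \<le> real CARD('m) * (\<tau> (Suc k) - \<tau> k) * (\<integral>\<omega>. (norm (\<xi> k \<omega>))\<^sup>2 \<partial>M)"
        by (intro mult_right_mono mult_left_mono) auto
      moreover have "real CARD('m) * (\<Sum>i<Suc k. (\<tau> (Suc i) - \<tau> i) * (\<integral>\<omega>. (norm (\<xi> i \<omega>))\<^sup>2 \<partial>M))
          = real CARD('m) * (\<Sum>i<k. (\<tau> (Suc i) - \<tau> i) * (\<integral>\<omega>. (norm (\<xi> i \<omega>))\<^sup>2 \<partial>M))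
            + real CARD('m) * (\<tau> (Suc k) - \<tau> k) * (\<integral>\<omega>. (norm (\<xi> k \<omega>))\<^sup>2 \<partial>M)"
        by (simp add: distrib_left mult.assoc)
      ultimately have "(\<integral>\<omega>. (norm (?S' \<omega>))\<^sup>2 \<partial>M)
          \<le> real CARD('m) * (\<Sum>i<Suc k. (\<tau> (Suc i) - \<tau> i) * (\<integral>\<omega>. (norm (\<xi> i \<omega>))\<^sup>2 \<partial>M))"
        using step(2) IH(3) unfolding S' by linarith
      then show ?thesis using step(1) m unfolding S' by blast
    qed
  qed
  show "simple_integral n \<tau> \<xi> W t \<in> borel_measurable M"
    using main[of n] usual_filtered_prob_space_measurable(2)[OF F] by blast
  show "integrable M (\<lambda>\<omega>. (norm (simple_integral n \<tau> \<xi> W t \<omega>))\<^sup>2)"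
    and "(\<integral>\<omega>. (norm (simple_integral n \<tau> \<xi> W t \<omega>))\<^sup>2 \<partial>M)
      \<le> real CARD('m) * (\<Sum>i<n. (\<tau> (Suc i) - \<tau> i) * (\<integral>\<omega>. (norm (\<xi> i \<omega>))\<^sup>2 \<partial>M))"
    using main[of n] by auto
qed

text \<open>The cells are half-open and the partition is nondecreasing, so they are pairwise
  disjoint, and cells of length zero are empty.\<close>

lemma simple_process_eq:
  assumes mono: "\<forall>i<n. \<tau> i \<le> \<tau> (Suc i)" and i: "i < n" "s \<in> {\<tau> i<..\<tau> (Suc i)}"
  shows "j < n \<Longrightarrow> s \<in> {\<tau> j<..\<tau> (Suc j)} \<longleftrightarrow> j = i"
    and "simple_process n \<tau> \<xi> s \<omega> = \<xi> i \<omega>"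
proof -
  have le: "k \<le> l \<Longrightarrow> l \<le> n \<Longrightarrow> \<tau> k \<le> \<tau> l" for k l
    by (induction l rule: dec_induct) (use mono in \<open>auto intro: order_trans\<close>)
  have un: "s \<in> {\<tau> j<..\<tau> (Suc j)} \<longleftrightarrow> j = i" if "j < n" for j
  proof
    assume "s \<in> {\<tau> j<..\<tau> (Suc j)}"
    then show "j = i"
      using le[of "Suc j" i] le[of "Suc i" j] i that by (cases i j rule: linorder_cases) auto
  qed (use i in simp)
  then show "j < n \<Longrightarrow> s \<in> {\<tau> j<..\<tau> (Suc j)} \<longleftrightarrow> j = i" .
  have "simple_process n \<tau> \<xi> s \<omega> = (\<Sum>j<n. if j = i then \<xi> i \<omega> else 0)"
    unfolding simple_process_def by (intro sum.cong refl) (use un in \<open>auto simp: indicator_def\<close>)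
  then show "simple_process n \<tau> \<xi> s \<omega> = \<xi> i \<omega>" using i by simp
qed

text \<open>
  The iterated integral on the right may have a non-measurable integrand, since \<open>H\<close> is only bounded;
  the proof therefore compares it with the measurable lower bounds \<open>g i = (|\<xi> i|\<^sup>2 / 2 - K\<^sup>2)\<^sup>+\<close>.
\<close>

lemma simple_data_energy_le:
  fixes \<xi> :: "nat \<Rightarrow> 'w \<Rightarrow> real^'m^'d"
  assumes F: "usual_filtered_prob_space M F" and sd: "simple_data M F T n \<tau> \<xi>"
    and H: "\<And>s \<omega>. s \<in> {0..T} \<Longrightarrow> \<omega> \<in> space M \<Longrightarrow> norm (H s \<omega>) \<le> K"
  shows "ennreal (\<Sum>i<n. (\<tau> (Suc i) - \<tau> i) * (\<integral>\<omega>. (norm (\<xi> i \<omega>))\<^sup>2 \<partial>M))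
    \<le> ennreal (2 * K\<^sup>2 * T) + 2 * (\<integral>\<^sup>+ \<omega>. (\<integral>\<^sup>+ s\<in>{0..T}.
            ennreal ((norm (simple_process n \<tau> \<xi> s \<omega> - H s \<omega>))\<^sup>2) \<partial>lborel) \<partial>M)"
proof -
  interpret prob_space M using F unfolding usual_filtered_prob_space_def by blast
  obtain C where C: "\<And>i \<omega>. i < n \<Longrightarrow> \<omega> \<in> space M \<Longrightarrow> norm (\<xi> i \<omega>) \<le> C"
    using sd unfolding simple_data_def by blast
  have \<tau>: "0 \<le> \<tau> 0" "\<forall>i<n. \<tau> i \<le> \<tau> (Suc i)" "\<tau> n \<le> T"
    using sd unfolding simple_data_def by auto
  have le: "k \<le> l \<Longrightarrow> l \<le> n \<Longrightarrow> \<tau> k \<le> \<tau> l" for k l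
    by (induction l rule: dec_induct) (use \<tau>(2) in \<open>auto intro: order_trans\<close>)
  have \<xi>m: "\<xi> i \<in> borel_measurable M" if "i < n" for i
    using sd that usual_filtered_prob_space_measurable(2)[OF F] unfolding simple_data_def by blast
  \<comment> \<open>The smallest nonnegative function with \<open>(norm (\<xi> i \<omega>))\<^sup>2
    \<le> 2 * K\<^sup>2 + 2 * g i \<omega>\<close>. Since \<open>H\<close> is bounded by
    \<open>K\<close>, the triangle inequality puts it below the squared distance from
    \<open>\<xi> i\<close> to \<open>H\<close> on the \<open>i\<close>-th cell.\<close>
  define g where "g i \<omega> = max 0 ((norm (\<xi> i \<omega>))\<^sup>2 / 2 - K\<^sup>2)" for i \<omega>
  define e where "e = (\<integral>\<^sup>+ \<omega>. (\<integral>\<^sup>+ s\<in>{0..T}.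
            ennreal ((norm (simple_process n \<tau> \<xi> s \<omega> - H s \<omega>))\<^sup>2) \<partial>lborel) \<partial>M)"
  have gm: "g i \<in> borel_measurable M" if "i < n" for i
    unfolding g_def using \<xi>m[OF that] by measurable
  have gi: "integrable M (g i)" if "i < n" for i
  proof (rule integrable_const_bound[of _ "C\<^sup>2"])
    show "AE \<omega> in M. norm (g i \<omega>) \<le> C\<^sup>2"
    proof (rule AE_I2)
      fix \<omega> assume "\<omega> \<in> space M"
      then have "(norm (\<xi> i \<omega>))\<^sup>2 \<le> C\<^sup>2" using C[OF that] by (intro power_mono) auto
      then show "norm (g i \<omega>) \<le> C\<^sup>2"
        using zero_le_power2[of "norm (\<xi> i \<omega>)"] zero_le_power2[of K]
        unfolding g_def real_norm_def by linarith
    qed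
  qed (rule gm[OF that])
  have \<xi>i: "integrable M (\<lambda>\<omega>. (norm (\<xi> i \<omega>))\<^sup>2)" if "i < n" for i
    by (rule integrable_const_bound[of _ "C\<^sup>2"]) (use \<xi>m C that in \<open>auto intro!: AE_I2 power_mono\<close>)
  have pt: "(\<Sum>i<n. ennreal (\<tau> (Suc i) - \<tau> i) * ennreal (g i \<omega>)) \<le>
      (\<integral>\<^sup>+ s\<in>{0..T}. ennreal ((norm (simple_process n \<tau> \<xi> s \<omega> - H s \<omega>))\<^sup>2) \<partial>lborel)"
    if \<omega>: "\<omega> \<in> space M" for \<omega>
  proof -
    have "(\<Sum>i<n. ennreal (\<tau> (Suc i) - \<tau> i) * ennreal (g i \<omega>))
        = (\<Sum>i<n. \<integral>\<^sup>+ s. ennreal (g i \<omega>) * indicator {\<tau> i<..\<tau> (Suc i)} s \<partial>lborel)"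
      using \<tau>(2) by (intro sum.cong refl) (auto simp: nn_integral_cmult_indicator mult.commute)
    also have "\<dots> = (\<integral>\<^sup>+ s. (\<Sum>i<n. ennreal (g i \<omega>) * indicator {\<tau> i<..\<tau> (Suc i)} s) \<partial>lborel)"
      by (intro nn_integral_sum[symmetric]) auto
    also have "\<dots> \<le> (\<integral>\<^sup>+ s\<in>{0..T}. ennreal ((norm (simple_process n \<tau> \<xi> s \<omega> - H s \<omega>))\<^sup>2) \<partial>lborel)"
    proof (rule nn_integral_mono)
      fix s :: real
      show "(\<Sum>i<n. ennreal (g i \<omega>) * indicator {\<tau> i<..\<tau> (Suc i)} s)
        \<le> ennreal ((norm (simple_process n \<tau> \<xi> s \<omega> - H s \<omega>))\<^sup>2) * indicator {0..T} s"
      proof (cases "\<exists>i<n. s \<in> {\<tau> i<..\<tau> (Suc i)}")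
        case False
        then have "(\<Sum>i<n. ennreal (g i \<omega>) * indicator {\<tau> i<..\<tau> (Suc i)} s) = 0"
          by (intro sum.neutral) (auto simp: indicator_def)
        then show ?thesis by simp
      next
        case True
        then obtain i where i: "i < n" "s \<in> {\<tau> i<..\<tau> (Suc i)}" by blast
        have s: "s \<in> {0..T}" using i le[of 0 i] le[of "Suc i" n] \<tau> by auto
        have sp: "simple_process n \<tau> \<xi> s \<omega> = \<xi> i \<omega>" by (rule simple_process_eq(2)[OF \<tau>(2) i])
        have "(\<Sum>j<n. ennreal (g j \<omega>) * indicator {\<tau> j<..\<tau> (Suc j)} s)
            = (\<Sum>j<n. if j = i then ennreal (g i \<omega>) else 0)"
          using simple_process_eq(1)[OF \<tau>(2) i]
          by (intro sum.cong refl) (auto simp: indicator_def)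
        also have "\<dots> = ennreal (g i \<omega>)" using i by simp
        also have "\<dots> \<le> ennreal ((norm (\<xi> i \<omega> - H s \<omega>))\<^sup>2)"
        proof (rule ennreal_leI)
          have "norm (\<xi> i \<omega>) \<le> norm (\<xi> i \<omega> - H s \<omega>) + norm (H s \<omega>)"
            using norm_triangle_ineq[of "\<xi> i \<omega> - H s \<omega>" "H s \<omega>"] by simp
          then have "norm (\<xi> i \<omega>) \<le> norm (\<xi> i \<omega> - H s \<omega>) + K" using H[OF s \<omega>] by simp
          then have "(norm (\<xi> i \<omega>))\<^sup>2 \<le> (norm (\<xi> i \<omega> - H s \<omega>) + K)\<^sup>2" by (intro power_mono) auto
          also have "\<dots> \<le> 2 * (norm (\<xi> i \<omega> - H s \<omega>))\<^sup>2 + 2 * K\<^sup>2"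
            using zero_le_power2[of "norm (\<xi> i \<omega> - H s \<omega>) - K"]
            by (simp add: power2_eq_square algebra_simps)
          finally show "g i \<omega> \<le> (norm (\<xi> i \<omega> - H s \<omega>))\<^sup>2" unfolding g_def by simp
        qed
        finally show ?thesis using s sp by simp
      qed
    qed
    finally show ?thesis .
  qed
  have ge: "(\<Sum>i<n. ennreal (\<tau> (Suc i) - \<tau> i) * ennreal (expectation (g i))) \<le> e"
  proof -
    have gme: "(\<lambda>\<omega>. ennreal (g i \<omega>)) \<in> borel_measurable M" if "i < n" for i
      using gm[OF that] by measurable
    have "(\<Sum>i<n. ennreal (\<tau> (Suc i) - \<tau> i) * ennreal (expectation (g i)))
        = (\<Sum>i<n. ennreal (\<tau> (Suc i) - \<tau> i) * (\<integral>\<^sup>+ \<omega>. ennreal (g i \<omega>) \<partial>M))"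
      using gi by (intro sum.cong refl arg_cong2[where f = "(*)"] nn_integral_eq_integral[symmetric])
        (auto simp: g_def)
    also have "\<dots> = (\<Sum>i<n. \<integral>\<^sup>+ \<omega>. ennreal (\<tau> (Suc i) - \<tau> i) * ennreal (g i \<omega>) \<partial>M)"
      by (intro sum.cong refl nn_integral_cmult[symmetric] gme) simp
    also have "\<dots> = (\<integral>\<^sup>+ \<omega>. (\<Sum>i<n. ennreal (\<tau> (Suc i) - \<tau> i) * ennreal (g i \<omega>)) \<partial>M)"
      by (intro nn_integral_sum[symmetric] borel_measurable_times_ennreal borel_measurable_const gme) simp
    also have "\<dots> \<le> e" unfolding e_def by (intro nn_integral_mono pt)
    finally show ?thesis .
  qed
  have tele: "(\<Sum>i<n. \<tau> (Suc i) - \<tau> i) = \<tau> n - \<tau> 0" by (rule sum_lessThan_telescope)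
  have nn: "0 \<le> expectation (g i)" for i by (intro Bochner_Integration.integral_nonneg) (simp add: g_def)
  have "(\<Sum>i<n. (\<tau> (Suc i) - \<tau> i) * (\<integral>\<omega>. (norm (\<xi> i \<omega>))\<^sup>2 \<partial>M))
      \<le> (\<Sum>i<n. (\<tau> (Suc i) - \<tau> i) * (2 * K\<^sup>2 + 2 * expectation (g i)))"
  proof (intro sum_mono mult_left_mono)
    fix i assume i: "i \<in> {..<n}"
    have "(\<integral>\<omega>. (norm (\<xi> i \<omega>))\<^sup>2 \<partial>M) \<le> expectation (\<lambda>\<omega>. 2 * K\<^sup>2 + 2 * g i \<omega>)"
    proof (rule integral_mono)
      show "integrable M (\<lambda>\<omega>. 2 * K\<^sup>2 + 2 * g i \<omega>)" using i gi by auto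
      show "(norm (\<xi> i \<omega>))\<^sup>2 \<le> 2 * K\<^sup>2 + 2 * g i \<omega>" for \<omega> by (auto simp: g_def max_def)
    qed (use i \<xi>i in auto)
    also have "\<dots> = 2 * K\<^sup>2 + 2 * expectation (g i)" using i gi by (simp add: prob_space)
    finally show "(\<integral>\<omega>. (norm (\<xi> i \<omega>))\<^sup>2 \<partial>M) \<le> 2 * K\<^sup>2 + 2 * expectation (g i)" .
  qed (use \<tau>(2) in auto)
  also have "\<dots> = 2 * K\<^sup>2 * (\<tau> n - \<tau> 0) + 2 * (\<Sum>i<n. (\<tau> (Suc i) - \<tau> i) * expectation (g i))"
    unfolding tele[symmetric] sum_distrib_left sum.distrib[symmetric]
    by (intro sum.cong refl) (simp add: algebra_simps)
  also have "\<dots> \<le> 2 * K\<^sup>2 * T + 2 * (\<Sum>i<n. (\<tau> (Suc i) - \<tau> i) * expectation (g i))"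
    using \<tau> by (intro add_right_mono mult_left_mono) auto
  finally have "ennreal (\<Sum>i<n. (\<tau> (Suc i) - \<tau> i) * (\<integral>\<omega>. (norm (\<xi> i \<omega>))\<^sup>2 \<partial>M))
      \<le> ennreal (2 * K\<^sup>2 * T + 2 * (\<Sum>i<n. (\<tau> (Suc i) - \<tau> i) * expectation (g i)))"
    by (rule ennreal_leI)
  also have "\<dots> = ennreal (2 * K\<^sup>2 * T) + 2 * (\<Sum>i<n. ennreal (\<tau> (Suc i) - \<tau> i) * ennreal (expectation (g i)))"
  proof -
    have T0: "0 \<le> T" using le[of 0 n] \<tau> by auto
    have nn': "0 \<le> (\<tau> (Suc i) - \<tau> i) * expectation (g i)" if "i < n" for i
      using \<tau>(2) nn that by auto
    have "ennreal (\<Sum>i<n. (\<tau> (Suc i) - \<tau> i) * expectation (g i))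
        = (\<Sum>i<n. ennreal (\<tau> (Suc i) - \<tau> i) * ennreal (expectation (g i)))"
      using nn' nn \<tau>(2) by (subst sum_ennreal[symmetric]) (auto intro!: sum.cong simp: ennreal_mult)
    moreover have "0 \<le> (\<Sum>i<n. (\<tau> (Suc i) - \<tau> i) * expectation (g i))"
      using nn' by (intro sum_nonneg) auto
    ultimately show ?thesis using T0 by (simp add: ennreal_mult')
  qed
  also have "\<dots> \<le> ennreal (2 * K\<^sup>2 * T) + 2 * e"
    by (intro add_left_mono mult_left_mono ge) auto
  finally show ?thesis unfolding e_def .
qed

text \<open>The bounds for the approximating simple integrals involve only \<open>K\<close> and the
  approximation error, which tends to 0. The constant 4 contains one factor 2 from comparing
  \<open>\<xi>\<close> with \<open>H\<close> and one from comparing the simple integral with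
  \<open>I t\<close>.\<close>

lemma ito_integral_moment2_le:
  fixes W :: "real \<Rightarrow> 'w \<Rightarrow> real^'m" and H :: "real \<Rightarrow> 'w \<Rightarrow> real^'m^'d"
  assumes F: "usual_filtered_prob_space M F" and W: "std_brownian_motion M F W"
    and I: "is_ito_integral M F W T H I"
    and H: "\<And>s \<omega>. s \<in> {0..T} \<Longrightarrow> \<omega> \<in> space M \<Longrightarrow> norm (H s \<omega>) \<le> K"
    and t: "t \<in> {0..T}"
  shows "moment2_le M (\<lambda>\<omega>. norm (I t \<omega>)) (4 * real CARD('m) * K\<^sup>2 * T)"
proof -
  interpret prob_space M using F unfolding usual_filtered_prob_space_def by blast
  obtain n \<tau> \<xi> where sd: "\<And>j::nat. simple_data M F T (n j) (\<tau> j) (\<xi> j)"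
    and e0: "(\<lambda>j. \<integral>\<^sup>+ \<omega>. (\<integral>\<^sup>+ s\<in>{0..T}.
            ennreal ((norm (simple_process (n j) (\<tau> j) (\<xi> j) s \<omega> - H s \<omega>))\<^sup>2) \<partial>lborel) \<partial>M)
          \<longlonglongrightarrow> 0"
    and d0: "(\<lambda>j. \<integral>\<^sup>+ \<omega>.
              ennreal ((norm (simple_integral (n j) (\<tau> j) (\<xi> j) W t \<omega> - I t \<omega>))\<^sup>2) \<partial>M)
            \<longlonglongrightarrow> 0"
    using I t unfolding is_ito_integral_def by blast
  define S where "S j = simple_integral (n j) (\<tau> j) (\<xi> j) W t" for j
  define e where "e j = (\<integral>\<^sup>+ \<omega>. (\<integral>\<^sup>+ s\<in>{0..T}.
            ennreal ((norm (simple_process (n j) (\<tau> j) (\<xi> j) s \<omega> - H s \<omega>))\<^sup>2) \<partial>lborel) \<partial>M)" for j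
  define d where "d j = (\<integral>\<^sup>+ \<omega>. ennreal ((norm (S j \<omega> - I t \<omega>))\<^sup>2) \<partial>M)" for j
  let ?m = "real CARD('m)"
  have T: "0 \<le> T" using t by auto
  have Im[measurable]: "I t \<in> borel_measurable M"
    using I t usual_filtered_prob_space_measurable(2)[OF F]
    unfolding is_ito_integral_def adapted_continuous_def by blast
  have Sm[measurable]: "S j \<in> borel_measurable M" for j
    unfolding S_def by (rule simple_integral_moment(1)[OF F W sd t])
  have S2: "(\<integral>\<^sup>+ \<omega>. ennreal ((norm (S j \<omega>))\<^sup>2) \<partial>M) \<le> ennreal ?m * (ennreal (2 * K\<^sup>2 * T) + 2 * e j)" for j
  proof -
    have "(\<integral>\<^sup>+ \<omega>. ennreal ((norm (S j \<omega>))\<^sup>2) \<partial>M) = ennreal (expectation (\<lambda>\<omega>. (norm (S j \<omega>))\<^sup>2))"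
      unfolding S_def by (rule nn_integral_eq_integral[OF simple_integral_moment(2)[OF F W sd t]]) simp
    also have "\<dots> \<le> ennreal (?m * (\<Sum>i<n j. (\<tau> j (Suc i) - \<tau> j i) * (\<integral>\<omega>. (norm (\<xi> j i \<omega>))\<^sup>2 \<partial>M)))"
      unfolding S_def by (rule ennreal_leI[OF simple_integral_moment(3)[OF F W sd t]])
    also have "\<dots> = ennreal ?m * ennreal (\<Sum>i<n j. (\<tau> j (Suc i) - \<tau> j i) * (\<integral>\<omega>. (norm (\<xi> j i \<omega>))\<^sup>2 \<partial>M))"
      by (rule ennreal_mult') simp
    also have "\<dots> \<le> ennreal ?m * (ennreal (2 * K\<^sup>2 * T) + 2 * e j)"
      unfolding e_def by (intro mult_left_mono simple_data_energy_le[OF F sd H]) auto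
    finally show ?thesis .
  qed
  have bound: "(\<integral>\<^sup>+ \<omega>. ennreal ((norm (I t \<omega>))\<^sup>2) \<partial>M)
      \<le> 2 * (ennreal ?m * (ennreal (2 * K\<^sup>2 * T) + 2 * e j)) + 2 * d j" for j
  proof -
    have "(\<integral>\<^sup>+ \<omega>. ennreal ((norm (I t \<omega>))\<^sup>2) \<partial>M)
      \<le> (\<integral>\<^sup>+ \<omega>. 2 * ennreal ((norm (S j \<omega>))\<^sup>2) + 2 * ennreal ((norm (S j \<omega> - I t \<omega>))\<^sup>2) \<partial>M)"
    proof (rule nn_integral_mono)
      fix \<omega>
      have "norm (I t \<omega>) \<le> norm (S j \<omega>) + norm (S j \<omega> - I t \<omega>)"
        using norm_triangle_sub[of "I t \<omega>" "S j \<omega>"] by (simp add: norm_minus_commute)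
      then have "(norm (I t \<omega>))\<^sup>2 \<le> (norm (S j \<omega>) + norm (S j \<omega> - I t \<omega>))\<^sup>2" by (intro power_mono) auto
      also have "\<dots> \<le> 2 * (norm (S j \<omega>))\<^sup>2 + 2 * (norm (S j \<omega> - I t \<omega>))\<^sup>2"
        using zero_le_power2[of "norm (S j \<omega>) - norm (S j \<omega> - I t \<omega>)"]
        by (simp add: power2_eq_square algebra_simps)
      finally show "ennreal ((norm (I t \<omega>))\<^sup>2)
          \<le> 2 * ennreal ((norm (S j \<omega>))\<^sup>2) + 2 * ennreal ((norm (S j \<omega> - I t \<omega>))\<^sup>2)"
        using ennreal_leI[of "(norm (I t \<omega>))\<^sup>2"] by (fastforce simp: ennreal_mult')
    qed
    also have "\<dots> = 2 * (\<integral>\<^sup>+ \<omega>. ennreal ((norm (S j \<omega>))\<^sup>2) \<partial>M) + 2 * d j"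
      unfolding d_def by (simp add: nn_integral_add nn_integral_cmult)
    also have "\<dots> \<le> 2 * (ennreal ?m * (ennreal (2 * K\<^sup>2 * T) + 2 * e j)) + 2 * d j"
      by (intro add_right_mono mult_left_mono S2) auto
    finally show ?thesis .
  qed
  have "(\<lambda>j. 2 * (ennreal ?m * (ennreal (2 * K\<^sup>2 * T) + 2 * e j)) + 2 * d j)
      \<longlonglongrightarrow> 2 * (ennreal ?m * (ennreal (2 * K\<^sup>2 * T) + 2 * 0)) + 2 * 0"
    using e0 d0 unfolding e_def d_def S_def
    by (intro tendsto_add ennreal_tendsto_cmult tendsto_const) (auto simp: less_top[symmetric])
  then have "(\<integral>\<^sup>+ \<omega>. ennreal ((norm (I t \<omega>))\<^sup>2) \<partial>M) \<le> 2 * (ennreal ?m * (ennreal (2 * K\<^sup>2 * T) + 2 * 0)) + 2 * 0"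
    using bound by (intro LIMSEQ_le_const) auto
  also have "\<dots> = ennreal (4 * ?m * K\<^sup>2 * T)"
    using ennreal_mult'[of 2 "?m * (2 * K\<^sup>2 * T)"] ennreal_mult'[of ?m "2 * K\<^sup>2 * T"]
    by (simp add: mult_ac)
  finally show ?thesis using T unfolding moment2_le_def by simp
qed


section \<open>The two equations\<close>

text \<open>Links the matrix used in the equation for \<open>V\<close> with the iterated derivatives
  used in \<open>Ckb\<close>. The order \<open>Suc k\<close> supplies the differentiability that
  makes the Frechet derivative linear, hence represented by its matrix.\<close>

lemma matrix_vector_mult_jacobian:
  fixes f :: "real^'n \<Rightarrow> real^'d"
  assumes "Ckb (Suc k) f"
  shows "jacobian f (at x) *v v = nderiv f [v] x"
proof -
  have "nderiv f [] differentiable (at x)"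
    using assms unfolding Ckb_def by (metis list.size(3) zero_less_Suc)
  then have "linear (frechet_derivative f (at x))"
    by (simp add: frechet_derivative_works has_derivative_linear)
  then show ?thesis unfolding jacobian_def by (simp add: matrix_works)
qed

text \<open>\<open>Ckb\<close> leaves the sign of its bound open; taking \<open>max 0 B\<close>
  makes it usable as a Gronwall constant.\<close>

lemma Ckb_bound:
  fixes f :: "'a::euclidean_space \<Rightarrow> 'b::real_normed_vector"
  assumes "Ckb k f" "j \<in> {1..k}"
  shows "\<exists>B\<ge>0. \<forall>vs x. length vs = j \<longrightarrow> norm (nderiv f vs x) \<le> B * prod_list (map norm vs)"
proof -
  obtain B where B: "\<And>vs x. length vs = j \<Longrightarrow> norm (nderiv f vs x) \<le> B * prod_list (map norm vs)"
    using assms unfolding Ckb_def by blast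
  have "B * prod_list (map norm vs) \<le> max 0 B * prod_list (map norm vs)" for vs :: "'a list"
    by (intro mult_right_mono prod_list_nonneg) auto
  then show ?thesis using B by (intro exI[of _ "max 0 B"]) (auto intro: order_trans)
qed

text \<open>Each entry of the product is a coordinate of the Jacobian applied to a column of
  \<open>\<sigma>\<close>. The Frobenius norm is bounded crudely by the sum of all entries, so the
  outer sum merely counts rows.\<close>

lemma norm_jacobian_mult_le:
  fixes f :: "real^'n \<Rightarrow> real^'d" and \<sigma> :: "real^'m^'n"
  assumes J: "\<And>x v. norm (jacobian f (at x) *v v) \<le> B * norm v"
  shows "norm (jacobian f (at x) ** \<sigma>) \<le> (\<Sum>i\<in>(UNIV::'d set). \<Sum>k\<in>UNIV. B * norm (column k \<sigma>))"
proof -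
  let ?P = "jacobian f (at x) ** \<sigma>"
  have "norm ?P \<le> (\<Sum>i\<in>UNIV. norm (?P $ i))"
    unfolding norm_vec_def[of ?P] by (rule L2_set_le_sum) auto
  also have "\<dots> \<le> (\<Sum>i\<in>UNIV. \<Sum>k\<in>UNIV. \<bar>?P $ i $ k\<bar>)"
    by (intro sum_mono norm_le_l1_cart)
  also have "\<dots> \<le> (\<Sum>i\<in>(UNIV::'d set). \<Sum>k\<in>UNIV. B * norm (column k \<sigma>))"
  proof (intro sum_mono)
    fix i k
    have "?P $ i $ k = (jacobian f (at x) *v column k \<sigma>) $ i"
      by (simp add: matrix_matrix_mult_def matrix_vector_mult_def column_def)
    then have "\<bar>?P $ i $ k\<bar> \<le> norm (jacobian f (at x) *v column k \<sigma>)"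
      by (simp add: component_le_norm_cart)
    then show "\<bar>?P $ i $ k\<bar> \<le> B * norm (column k \<sigma>)" using J order_trans by blast
  qed
  finally show ?thesis .
qed

lemma adapted_continuousD:
  assumes F: "usual_filtered_prob_space M F" and Y: "adapted_continuous M F S Y"
  shows "t \<in> S \<Longrightarrow> Y t \<in> borel_measurable M"
    and "\<omega> \<in> space M \<Longrightarrow> continuous_on S (\<lambda>t. Y t \<omega>)"
  using Y usual_filtered_prob_space_measurable(2)[OF F] unfolding adapted_continuous_def by blast+

section \<open>Second moments of the two solutions\<close>

text \<open>Linear growth of the drift gives Gronwall with rate \<open>L\<close> and forcing
  \<open>norm X0 + c * T + norm (I t \<omega>)\<close>. The diffusion integrand is the constant
  \<open>\<sigma>\<close>, so \<open>norm \<sigma>\<close> serves as its bound.\<close>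

lemma sde_solution_moment2_le:
  fixes f :: "real^'d \<Rightarrow> real^'d" and \<sigma> :: "real^'m^'d"
  assumes F: "usual_filtered_prob_space M F" and W: "std_brownian_motion M F W"
    and X: "sde_solution M F W T f \<sigma> X0 X"
    and L: "0 \<le> L" and f: "\<And>x. norm (f x) \<le> c + L * norm x" and t: "t \<in> {0..T}"
  shows "moment2_le M (\<lambda>\<omega>. norm (X t \<omega>))
    ((2 + 2 * (L * exp (L * T))\<^sup>2 * T\<^sup>2)
      * (2 * (norm X0 + c * T)\<^sup>2 + 2 * (4 * real CARD('m) * (norm \<sigma>)\<^sup>2 * T)))"
proof -
  interpret prob_space M using F unfolding usual_filtered_prob_space_def by blast
  obtain I where Xc: "adapted_continuous M F {0..T} X"
    and I: "is_ito_integral M F W T (\<lambda>s \<omega>. \<sigma>) I"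
    and eq: "AE \<omega> in M. \<forall>t\<in>{0..T}. X t \<omega> = X0 + integral {0..t} (\<lambda>s. f (X s \<omega>)) + I t \<omega>"
    using X unfolding sde_solution_def by blast
  have Ic: "adapted_continuous M F {0..T} I" using I unfolding is_ito_integral_def by blast
  have T: "0 \<le> T" using t by auto
  have c: "0 \<le> c" using f[of 0] by (simp add: order_trans[OF norm_ge_zero])
  define a where "a t \<omega> = (norm X0 + c * T) + norm (I t \<omega>)" for t \<omega>
  show ?thesis
  proof (rule moment2_le_gronwall[where a = a and v = "\<lambda>t \<omega>. norm (X t \<omega>)", OF t L])
    show "(\<lambda>\<omega>. norm (X t \<omega>)) \<in> borel_measurable M"
      using adapted_continuousD(1)[OF F Xc t] by measurable
    show "continuous_on {0..T} (\<lambda>t. norm (X t \<omega>))" if "\<omega> \<in> space M" for \<omega>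
      using adapted_continuousD(2)[OF F Xc that] by (intro continuous_intros)
    show "continuous_on {0..T} (\<lambda>t. a t \<omega>)" if "\<omega> \<in> space M" for \<omega>
      unfolding a_def using adapted_continuousD(2)[OF F Ic that] by (intro continuous_intros)
    show "0 \<le> a t \<omega>" for t \<omega> unfolding a_def using T c by auto
    show "moment2_le M (a t) (2 * (norm X0 + c * T)\<^sup>2 + 2 * (4 * real CARD('m) * (norm \<sigma>)\<^sup>2 * T))"
      if "t \<in> {0..T}" for t
      unfolding a_def
      by (intro moment2_le_add moment2_le_const ito_integral_moment2_le[OF F W I _ that]) simp
    show "AE \<omega> in M. \<forall>t\<in>{0..T}. norm (X t \<omega>) \<le> a t \<omega> + L * integral {0..t} (\<lambda>s. norm (X s \<omega>))"
      using eq AE_space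
    proof eventually_elim
      case (elim \<omega>)
      show ?case
      proof
        fix t assume t: "t \<in> {0..T}"
        have "continuous_on {0..t} (\<lambda>s. norm (X s \<omega>))"
          using t
          by (intro continuous_on_norm continuous_on_subset[OF adapted_continuousD(2)[OF F Xc elim(2)]]) auto
        then have Xi: "(\<lambda>s. norm (X s \<omega>)) integrable_on {0..t}" by (rule integrable_continuous_real)
        have "norm (integral {0..t} (\<lambda>s. f (X s \<omega>))) \<le> integral {0..t} (\<lambda>s. c + L * norm (X s \<omega>))"
          using f by (intro norm_integral_le_integral integrable_add integrable_const_ivl
              integrable_on_mult_right Xi)
        also have "\<dots> = integral {0..t} (\<lambda>s. c) + integral {0..t} (\<lambda>s. L * norm (X s \<omega>))"
          by (intro Henstock_Kurzweil_Integration.integral_add integrable_const_ivl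
              integrable_on_mult_right Xi)
        also have "\<dots> = c * t + L * integral {0..t} (\<lambda>s. norm (X s \<omega>))" using t by simp
        also have "\<dots> \<le> c * T + L * integral {0..t} (\<lambda>s. norm (X s \<omega>))"
          using t c by (auto intro: mult_left_mono)
        finally have "norm (integral {0..t} (\<lambda>s. f (X s \<omega>))) \<le> \<dots>" .
        moreover have "norm (X t \<omega>) \<le> norm X0 + norm (integral {0..t} (\<lambda>s. f (X s \<omega>))) + norm (I t \<omega>)"
          using elim(1) t norm_triangle_ineq norm_triangle_mono by (metis order_refl)
        ultimately show "norm (X t \<omega>) \<le> a t \<omega> + L * integral {0..t} (\<lambda>s. norm (X s \<omega>))"
          unfolding a_def by linarith
      qed
    qed
  qed simp
qed

text \<open>The Jacobian bound \<open>B\<close> is the Gronwall rate. The drift terms carry a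
  prefactor \<open>T\<close> and a time integral over at most \<open>T\<close>, giving
  \<open>T ^ 4\<close> after squaring; the Ito terms carry \<open>T\<^sup>2\<close> times a moment
  linear in \<open>T\<close>, giving \<open>T ^ 3\<close>.\<close>

lemma limit_eq_solution_moment2_le:
  fixes f :: "real^'d \<Rightarrow> real^'d" and \<sigma> :: "real^'m^'d" and A :: "real^'s^'s"
  assumes F: "usual_filtered_prob_space M F" and W: "std_brownian_motion M F W"
    and W': "std_brownian_motion M F W'"
    and V: "limit_eq_solution M F W W' T f \<sigma> A b \<alpha> X V" and T: "0 \<le> T"
    and X: "adapted_continuous M F {0..T} X"
    and X2: "\<And>t. t \<in> {0..T} \<Longrightarrow> moment2_le M (\<lambda>\<omega>. norm (X t \<omega>)) CX"
    and L: "0 \<le> L" and c: "0 \<le> c" and f: "\<And>x. norm (f x) \<le> c + L * norm x"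
    and B: "0 \<le> B" and J: "\<And>x v. norm (jacobian f (at x) *v v) \<le> B * norm v"
    and K: "\<And>x. norm (jacobian f (at x) ** \<sigma>) \<le> K"
    and D: "\<And>x k. norm (second_deriv f x (column k \<sigma>) (column k \<sigma>)) \<le> D k"
  shows "moment2_le M (\<lambda>\<omega>. norm (V T \<omega>))
    ((2 + 2 * (B * exp (B * T))\<^sup>2 * T\<^sup>2) * ((1 + eta2 A b \<alpha>) *
      (4 * (B\<^sup>2 * T ^ 4 * (2 * c\<^sup>2 + 2 * (L\<^sup>2 * CX)) + (\<Sum>k\<in>UNIV. D k)\<^sup>2 * T ^ 4
        + 4 * real CARD('m) * K\<^sup>2 * T ^ 3))))"
proof -
  interpret prob_space M using F unfolding usual_filtered_prob_space_def by blast
  define c1 where "c1 = \<alpha> \<bullet> (A *v ones) - 1/2"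
  define c2 where "c2 = \<alpha> \<bullet> csquare b - 1/2"
  define c3 where "c3 = \<alpha> \<bullet> b - 1/2"
  obtain I I' where Vc: "adapted_continuous M F {0..T} V"
    and I: "is_ito_integral M F W T (\<lambda>s \<omega>. jacobian f (at (X s \<omega>)) ** \<sigma>) I"
    and I': "is_ito_integral M F W' T (\<lambda>s \<omega>. jacobian f (at (X s \<omega>)) ** \<sigma>) I'"
    and eq: "AE \<omega> in M. \<forall>t\<in>{0..T}.
           V t \<omega> =
             integral {0..t} (\<lambda>s. jacobian f (at (X s \<omega>)) *v V s \<omega>)
             + (c1 * T) *\<^sub>R integral {0..t} (\<lambda>s. jacobian f (at (X s \<omega>)) *v f (X s \<omega>))
             + (1/2 * c2 * T) *\<^sub>R
                 (\<Sum>k\<in>UNIV. integral {0..t}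
                    (\<lambda>s. second_deriv f (X s \<omega>) (column k \<sigma>) (column k \<sigma>)))
             + (c3 * T) *\<^sub>R I t \<omega>
             - (T / sqrt 12) *\<^sub>R I' t \<omega>"
    using V unfolding limit_eq_solution_def c1_def c2_def c3_def by blast
  have Ic: "adapted_continuous M F {0..T} I" and Ic': "adapted_continuous M F {0..T} I'"
    using I I' unfolding is_ito_integral_def by blast+
  have D0: "0 \<le> D k" for k using D by (meson norm_ge_zero order_trans)
  define D' where "D' = (\<Sum>k\<in>UNIV. D k)"
  \<comment> \<open>Integrated up to \<open>T\<close> for every \<open>t\<close>: the integrand is
    nonnegative, so this dominates the integral up to \<open>t\<close> and makes the contribution of
    \<open>X\<close> to the forcing constant in time.\<close>
  define Q where "Q \<omega> = integral {0..T} (\<lambda>s. c + L * norm (X s \<omega>))" for \<omega>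
  define a where "a t \<omega> = (\<bar>c1\<bar> * T * B * Q \<omega> + \<bar>c2\<bar> * T\<^sup>2 * D')
      + (\<bar>c3\<bar> * T * norm (I t \<omega>) + T / sqrt 12 * norm (I' t \<omega>))" for t \<omega>
  define CQ where "CQ = T\<^sup>2 * (2 * c\<^sup>2 + 2 * (L\<^sup>2 * CX))"
  define CI where "CI = 4 * real CARD('m) * K\<^sup>2 * T"
  have Xcont: "continuous_on {0..T} (\<lambda>s. norm (X s \<omega>))" if "\<omega> \<in> space M" for \<omega>
    using adapted_continuousD(2)[OF F X that] by (intro continuous_intros)
  have Vcont: "continuous_on {0..T} (\<lambda>s. norm (V s \<omega>))" if "\<omega> \<in> space M" for \<omega>
    using adapted_continuousD(2)[OF F Vc that] by (intro continuous_intros)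
  have qi: "(\<lambda>s. c + L * norm (X s \<omega>)) integrable_on {0..t}" if "\<omega> \<in> space M" "t \<in> {0..T}" for \<omega> t
    using that by (intro integrable_continuous_real continuous_on_add continuous_on_const
        continuous_on_mult_left continuous_on_subset[OF Xcont[OF that(1)]]) auto
  have q0: "0 \<le> c + L * norm (X s \<omega>)" for s \<omega> using c L by auto
  have Q0: "0 \<le> Q \<omega>" if "\<omega> \<in> space M" for \<omega>
    unfolding Q_def by (rule integral_nonneg[OF qi[OF that]]) (use q0 T in auto)
  have Q2: "moment2_le M Q CQ"
    unfolding Q_def CQ_def
    by (intro moment2_le_integral[OF T] moment2_le_add moment2_le_const moment2_le_cmult X2
        continuous_intros Xcont) auto
  have CQ0: "0 \<le> CQ" using Q2 unfolding moment2_le_def by blast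
  have CI0: "0 \<le> CI" using T by (simp add: CI_def)
  have D'0: "0 \<le> D'" unfolding D'_def by (intro sum_nonneg D0)
  have eta: "eta2 A b \<alpha> = c1\<^sup>2 + c2\<^sup>2 + c3\<^sup>2" by (simp add: eta2_def c1_def c2_def c3_def)
  \<comment> \<open>The factor 4 reflects that \<open>a\<close> is a sum of two pairs, so the
    inequality for the square of a sum is used twice.\<close>
  define CA where "CA = (1 + eta2 A b \<alpha>) * (4 * (B\<^sup>2 * T\<^sup>2 * CQ + D'\<^sup>2 * T ^ 4 + T\<^sup>2 * CI))"
  have a2: "moment2_le M (a t) CA" if t: "t \<in> {0..T}" for t
  proof -
    have "moment2_le M (a t)
        (2 * (2 * ((\<bar>c1\<bar> * T * B)\<^sup>2 * CQ) + 2 * (\<bar>c2\<bar> * T\<^sup>2 * D')\<^sup>2)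
         + 2 * (2 * ((\<bar>c3\<bar> * T)\<^sup>2 * CI) + 2 * ((T / sqrt 12)\<^sup>2 * CI)))"
      unfolding a_def CI_def
      by (intro moment2_le_add moment2_le_cmult moment2_le_const Q2
          ito_integral_moment2_le[OF F W I K t] ito_integral_moment2_le[OF F W' I' K t])
    moreover have "2 * (2 * ((\<bar>c1\<bar> * T * B)\<^sup>2 * CQ) + 2 * (\<bar>c2\<bar> * T\<^sup>2 * D')\<^sup>2)
         + 2 * (2 * ((\<bar>c3\<bar> * T)\<^sup>2 * CI) + 2 * ((T / sqrt 12)\<^sup>2 * CI)) \<le> CA"
    proof -
      define x y z where "x = B\<^sup>2 * T\<^sup>2 * CQ" and "y = D'\<^sup>2 * T ^ 4" and "z = T\<^sup>2 * CI"
      have xyz: "0 \<le> x" "0 \<le> y" "0 \<le> z" using CQ0 CI0 by (auto simp: x_def y_def z_def)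
      have "2 * (2 * ((\<bar>c1\<bar> * T * B)\<^sup>2 * CQ) + 2 * (\<bar>c2\<bar> * T\<^sup>2 * D')\<^sup>2)
         + 2 * (2 * ((\<bar>c3\<bar> * T)\<^sup>2 * CI) + 2 * ((T / sqrt 12)\<^sup>2 * CI))
         = 4 * (c1\<^sup>2 * x + c2\<^sup>2 * y + c3\<^sup>2 * z + z / 12)"
        by (simp add: x_def y_def z_def power_mult_distrib power_divide algebra_simps
            power_mult[symmetric])
      \<comment> \<open>Each squared coefficient is paired with the whole sum
        \<open>x + y + z\<close> so that \<open>eta2\<close> factors out; the 1 absorbs
        \<open>z / 12\<close>, the contribution of \<open>W'\<close>.\<close>
      also have "\<dots> \<le> 4 * ((1 + (c1\<^sup>2 + c2\<^sup>2 + c3\<^sup>2)) * (x + y + z))"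
      proof -
        have "c1\<^sup>2 * x \<le> c1\<^sup>2 * (x + y + z)" "c2\<^sup>2 * y \<le> c2\<^sup>2 * (x + y + z)"
          "c3\<^sup>2 * z \<le> c3\<^sup>2 * (x + y + z)" using xyz by (auto intro: mult_left_mono)
        then show ?thesis using xyz by (simp add: distrib_right)
      qed
      also have "\<dots> = CA" unfolding CA_def eta x_def y_def z_def by (rule mult.left_commute)
      finally show ?thesis .
    qed
    ultimately show ?thesis by (rule moment2_le_mono)
  qed
  have "moment2_le M (\<lambda>\<omega>. norm (V T \<omega>)) ((2 + 2 * (B * exp (B * T))\<^sup>2 * T\<^sup>2) * CA)"
  proof (rule moment2_le_gronwall[where a = a and v = "\<lambda>t \<omega>. norm (V t \<omega>)", OF _ B])
    show "T \<in> {0..T}" using T by auto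
    then show "(\<lambda>\<omega>. norm (V T \<omega>)) \<in> borel_measurable M"
      using adapted_continuousD(1)[OF F Vc] by measurable
    show "continuous_on {0..T} (\<lambda>t. norm (V t \<omega>))" if "\<omega> \<in> space M" for \<omega> by (rule Vcont[OF that])
    show "continuous_on {0..T} (\<lambda>t. a t \<omega>)" if "\<omega> \<in> space M" for \<omega>
      unfolding a_def
      using adapted_continuousD(2)[OF F Ic that] adapted_continuousD(2)[OF F Ic' that]
      by (intro continuous_intros)
    show "0 \<le> a t \<omega>" if "t \<in> {0..T}" "\<omega> \<in> space M" for t \<omega>
      unfolding a_def using T B D'0 Q0[OF that(2)] by (intro add_nonneg_nonneg mult_nonneg_nonneg) auto
    show "moment2_le M (a t) CA" if "t \<in> {0..T}" for t by (rule a2[OF that])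
    show "AE \<omega> in M. \<forall>t\<in>{0..T}. norm (V t \<omega>) \<le> a t \<omega> + B * integral {0..t} (\<lambda>s. norm (V s \<omega>))"
      using eq AE_space
    proof eventually_elim
      case (elim \<omega>)
      show ?case
      proof
        fix t assume t: "t \<in> {0..T}"
        let ?G1 = "integral {0..t} (\<lambda>s. jacobian f (at (X s \<omega>)) *v V s \<omega>)"
        let ?G2 = "integral {0..t} (\<lambda>s. jacobian f (at (X s \<omega>)) *v f (X s \<omega>))"
        let ?G3 = "\<Sum>k\<in>UNIV. integral {0..t}
                    (\<lambda>s. second_deriv f (X s \<omega>) (column k \<sigma>) (column k \<sigma>))"
        have Vi: "(\<lambda>s. norm (V s \<omega>)) integrable_on {0..t}"
          by (rule integrable_continuous_real, rule continuous_on_subset[OF Vcont[OF elim(2)]])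
            (use t in auto)
        have G1: "norm ?G1 \<le> B * integral {0..t} (\<lambda>s. norm (V s \<omega>))"
          using norm_integral_le_integral[OF integrable_on_mult_right[OF Vi] J] by simp
        have "norm ?G2 \<le> integral {0..t} (\<lambda>s. B * (c + L * norm (X s \<omega>)))"
        proof (rule norm_integral_le_integral)
          show "(\<lambda>s. B * (c + L * norm (X s \<omega>))) integrable_on {0..t}"
            by (rule integrable_on_mult_right[OF qi[OF elim(2) t]])
          show "norm (jacobian f (at (X s \<omega>)) *v f (X s \<omega>)) \<le> B * (c + L * norm (X s \<omega>))" for s
            using order_trans[OF J mult_left_mono[OF f B]] .
        qed
        also have "\<dots> = B * integral {0..t} (\<lambda>s. c + L * norm (X s \<omega>))" by simp
        also have "\<dots> \<le> B * Q \<omega>"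
          unfolding Q_def
          by (intro mult_left_mono integral_subset_le qi[OF elim(2)] B) (use t T q0 in auto)
        finally have G2: "norm ?G2 \<le> B * Q \<omega>" .
        have "norm ?G3 \<le> (\<Sum>k\<in>UNIV. norm (integral {0..t}
                    (\<lambda>s. second_deriv f (X s \<omega>) (column k \<sigma>) (column k \<sigma>))))"
          by (rule norm_sum)
        also have "\<dots> \<le> (\<Sum>k\<in>UNIV. integral {0..t} (\<lambda>s. D k))"
          by (intro sum_mono norm_integral_le_integral integrable_const_ivl D)
        also have "\<dots> = D' * t" using t unfolding D'_def sum_distrib_right by (simp add: mult.commute[of t])
        also have "\<dots> \<le> D' * T" using t D'0 by (intro mult_left_mono) auto
        finally have G3: "norm ?G3 \<le> D' * T" .
        have "norm (V t \<omega>) \<le> norm ?G1 + norm ((c1 * T) *\<^sub>R ?G2) + norm ((1/2 * c2 * T) *\<^sub>R ?G3)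
            + norm ((c3 * T) *\<^sub>R I t \<omega>) + norm ((T / sqrt 12) *\<^sub>R I' t \<omega>)"
          unfolding elim(1)[rule_format, OF t]
          by (intro order_trans[OF norm_triangle_ineq4] order_trans[OF norm_triangle_ineq]
              add_mono order_refl)
        also have "\<dots> = norm ?G1 + \<bar>c1\<bar> * T * norm ?G2 + 1/2 * (\<bar>c2\<bar> * T * norm ?G3)
            + \<bar>c3\<bar> * T * norm (I t \<omega>) + T / sqrt 12 * norm (I' t \<omega>)"
          using T by (simp add: abs_mult)
        also have "\<dots> \<le> B * integral {0..t} (\<lambda>s. norm (V s \<omega>)) + \<bar>c1\<bar> * T * (B * Q \<omega>)
            + \<bar>c2\<bar> * T * (D' * T) + \<bar>c3\<bar> * T * norm (I t \<omega>) + T / sqrt 12 * norm (I' t \<omega>)"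
        proof -
          have 1: "\<bar>c1\<bar> * T * norm ?G2 \<le> \<bar>c1\<bar> * T * (B * Q \<omega>)"
            using T by (intro mult_left_mono G2) auto
          have 2: "\<bar>c2\<bar> * T * norm ?G3 \<le> \<bar>c2\<bar> * T * (D' * T)"
            using T by (intro mult_left_mono G3) auto
          \<comment> \<open>The prefactor 1/2 of the second-derivative term is discarded here, which
            matches its absence from \<open>a\<close>.\<close>
          have "0 \<le> \<bar>c2\<bar> * T * norm ?G3" using T by simp
          then have "1/2 * (\<bar>c2\<bar> * T * norm ?G3) \<le> \<bar>c2\<bar> * T * (D' * T)" using 2 by linarith
          then show ?thesis using G1 1 by (intro add_mono) auto
        qed
        also have "\<dots> = a t \<omega> + B * integral {0..t} (\<lambda>s. norm (V s \<omega>))"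
          unfolding a_def by (simp add: power2_eq_square mult_ac)
        finally show "norm (V t \<omega>) \<le> a t \<omega> + B * integral {0..t} (\<lambda>s. norm (V s \<omega>))" .
      qed
    qed
  qed simp
  moreover have "CA = (1 + eta2 A b \<alpha>) *
      (4 * (B\<^sup>2 * T ^ 4 * (2 * c\<^sup>2 + 2 * (L\<^sup>2 * CX)) + (\<Sum>k\<in>UNIV. D k)\<^sup>2 * T ^ 4
        + 4 * real CARD('m) * K\<^sup>2 * T ^ 3))"
    unfolding CA_def CQ_def CI_def D'_def
    by (simp add: power2_eq_square power3_eq_cube power4_eq_xxxx mult_ac)
  ultimately show ?thesis by simp
qed

section \<open>Choice of the constant and conclusion\<close>

theorem theorem5p6:
  fixes f :: "real^'d \<Rightarrow> real^'d"
    and \<sigma> :: "real^'m^'d"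
    and X0 :: "real^'d"
    and A :: "real^'s^'s"
    and b \<alpha> :: "real^'s"
  assumes "\<exists>L. L-lipschitz_on UNIV f"
    and "Ckb 4 f"
    and "\<alpha> \<bullet> ones = 1"
  shows "\<exists>L2>0. \<forall>T\<ge>1.
    \<forall>(M :: 'w measure) F (W :: real \<Rightarrow> 'w \<Rightarrow> real^'m) W' X V.
      usual_filtered_prob_space M F \<longrightarrow>
      std_brownian_motion M F W \<longrightarrow>
      std_brownian_motion M F W' \<longrightarrow>
      indep_processes M W W' \<longrightarrow>
      sde_solution M F W T f \<sigma> X0 X \<longrightarrow>
      limit_eq_solution M F W W' T f \<sigma> A b \<alpha> X V \<longrightarrow>
        integrable M (\<lambda>\<omega>. (norm (V T \<omega>))\<^sup>2) \<and>
        (\<integral>\<omega>. (norm (V T \<omega>))\<^sup>2 \<partial>M) \<le> exp (L2 * T) * (1 + eta2 A b \<alpha>) * T ^ 3"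
proof -
  obtain L where Lip: "L-lipschitz_on UNIV f" using assms(1) by blast
  have L: "0 \<le> L" by (rule lipschitz_on_nonneg[OF Lip])
  define c where "c = norm (f 0)"
  have c: "0 \<le> c" by (simp add: c_def)
  have f: "norm (f x) \<le> c + L * norm x" for x
  proof -
    have "norm (f x - f 0) \<le> L * norm x"
      using lipschitz_onD[OF Lip, of x 0] by (simp add: dist_norm)
    then show ?thesis using norm_triangle_sub[of "f x" "f 0"] by (simp add: c_def)
  qed
  obtain B where B: "0 \<le> B"
    and B1: "\<And>vs x. length vs = 1 \<Longrightarrow> norm (nderiv f vs x) \<le> B * prod_list (map norm vs)"
    using Ckb_bound[OF assms(2), of 1] by auto
  obtain B' where
    B2: "\<And>vs x. length vs = 2 \<Longrightarrow> norm (nderiv f vs x) \<le> B' * prod_list (map norm vs)"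
    using Ckb_bound[OF assms(2), of 2] by auto
  have J: "norm (jacobian f (at x) *v v) \<le> B * norm v" for x v
    using B1[of "[v]" x] matrix_vector_mult_jacobian[of 3 f x v] assms(2)
    by (simp add: eval_nat_numeral)
  define D where "D k = B' * (norm (column k \<sigma>) * norm (column k \<sigma>))" for k
  have D: "norm (second_deriv f x (column k \<sigma>) (column k \<sigma>)) \<le> D k" for x k
    using B2[of "[column k \<sigma>, column k \<sigma>]" x] by (simp add: D_def)
  define K where "K = (\<Sum>i\<in>(UNIV::'d set). \<Sum>k\<in>UNIV. B * norm (column k \<sigma>))"
  have K: "norm (jacobian f (at x) ** \<sigma>) \<le> K" for x
    unfolding K_def by (rule norm_jacobian_mult_le[OF J])
  define CX where "CX T = (2 + 2 * (L * exp (L * T))\<^sup>2 * T\<^sup>2)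
      * (2 * (norm X0 + c * T)\<^sup>2 + 2 * (4 * real CARD('m) * (norm \<sigma>)\<^sup>2 * T))" for T
  \<comment> \<open>The bound on the moment of \<open>V\<close> with
    \<open>1 + eta2 A b \<alpha>\<close> divided out. It contains the bounds on \<open>f\<close> and
    its derivatives, \<open>\<sigma>\<close>, \<open>X0\<close> and the dimension of the noise, but
    neither the probability space nor \<open>A\<close>, \<open>b\<close>, \<open>\<alpha>\<close>;
    so the rate \<open>q\<close> depends on none of the latter.\<close>
  define P where "P T = (2 + 2 * (B * exp (B * T))\<^sup>2 * T\<^sup>2) *
      (4 * (B\<^sup>2 * T ^ 4 * (2 * c\<^sup>2 + 2 * (L\<^sup>2 * CX T)) + (\<Sum>k\<in>UNIV. D k)\<^sup>2 * T ^ 4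
        + 4 * real CARD('m) * K\<^sup>2 * T ^ 3))" for T
  have "exp_bounded P"
    unfolding P_def[abs_def] CX_def by (intro exp_bounded_intros)
  then obtain q where q: "\<And>T. 1 \<le> T \<Longrightarrow> \<bar>P T\<bar> \<le> exp (q * T)" unfolding exp_bounded_def by blast
  have eta: "0 \<le> eta2 A b \<alpha>" by (simp add: eta2_def)
  show ?thesis
  \<comment> \<open>The maximum with 1 secures positivity, as \<open>q\<close> may have any
    sign.\<close>
  proof (intro exI[of _ "max 1 q"] conjI allI impI)
    fix T :: real and M :: "'w measure" and F and W W' :: "real \<Rightarrow> 'w \<Rightarrow> real^'m" and X V
    assume T: "1 \<le> T" and F: "usual_filtered_prob_space M F"
      and W: "std_brownian_motion M F W" and W': "std_brownian_motion M F W'"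
      and X: "sde_solution M F W T f \<sigma> X0 X" and V: "limit_eq_solution M F W W' T f \<sigma> A b \<alpha> X V"
    have Xc: "adapted_continuous M F {0..T} X" using X unfolding sde_solution_def by blast
    have X2: "moment2_le M (\<lambda>\<omega>. norm (X t \<omega>)) (CX T)" if "t \<in> {0..T}" for t
      unfolding CX_def by (rule sde_solution_moment2_le[OF F W X L f that])
    have T0: "0 \<le> T" using T by simp
    have "moment2_le M (\<lambda>\<omega>. norm (V T \<omega>)) ((1 + eta2 A b \<alpha>) * P T)"
      using limit_eq_solution_moment2_le[OF F W W' V T0 Xc X2 L c f B J K D]
      unfolding P_def by (simp only: mult.left_commute)
    note V2 = moment2_leD[OF this]
    show "integrable M (\<lambda>\<omega>. (norm (V T \<omega>))\<^sup>2)" by (rule V2(1))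
    have "P T \<le> exp (max 1 q * T)"
    proof -
      have "P T \<le> exp (q * T)" using q[OF T] by linarith
      also have "\<dots> \<le> exp (max 1 q * T)" using T by (auto intro: mult_right_mono)
      finally show ?thesis .
    qed
    then have "(1 + eta2 A b \<alpha>) * P T \<le> (1 + eta2 A b \<alpha>) * exp (max 1 q * T)"
      using eta by (intro mult_left_mono) auto
    \<comment> \<open>All powers of \<open>T\<close> are already inside the exponential; multiplying
      by \<open>T ^ 3 \<ge> 1\<close> only weakens the bound.\<close>
    also have "\<dots> \<le> (1 + eta2 A b \<alpha>) * exp (max 1 q * T) * T ^ 3"
      using mult_left_mono[OF one_le_power[OF T, of 3], of "(1 + eta2 A b \<alpha>) * exp (max 1 q * T)"] eta
      by simp
    finally show "(\<integral>\<omega>. (norm (V T \<omega>))\<^sup>2 \<partial>M) \<le> exp (max 1 q * T) * (1 + eta2 A b \<alpha>) * T ^ 3"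
      using V2(2) by (simp add: mult_ac)
  qed simp
qed

end
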